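(* Let $X$ be a separable infinite dimensional complex Banach space. Then for every integer $m\geq 1$ there exists a hypercyclic (continuous) $m$-linear operator $M:X^m\to X$.
   Context: For a continuous $m$-linear operator $M:X^m\to X$ and initial conditions $(x_{1-m},\dots,x_0)\in X^m$, define inductively $x_n:=M(x_{n-m},\dots,x_{n-1})$ for $n\geq 1$, and $\mathrm{Orb}_M(x_{1-m},\dots,x_0):=\{x_n : n\geq 1-m\}$. The operator $M$ is called hypercyclic if there exists $(x_{1-m},\dots,x_0)\in X^m$ such that $\mathrm{Orb}_M(x_{1-m},\dots,x_0)$ is dense in $X$. *)

theory Defs
  imports "HOL-Analysis.Analysis"
begin

text \<open>
  The distribution only has real Banach spaces. A complex Banach space is a real Banach space whose
  real scalar multiplication is the restriction of a complex one for which the norm is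
  absolutely homogeneous.
\<close>

class complex_banach = banach +
  fixes scaleC :: "complex \<Rightarrow> 'a \<Rightarrow> 'a"  (infixr \<open>*\<^sub>C\<close> 75)
  assumes scaleC_add_right: "a *\<^sub>C (x + y) = a *\<^sub>C x + a *\<^sub>C y"
    and scaleC_add_left: "(a + b) *\<^sub>C x = a *\<^sub>C x + b *\<^sub>C x"
    and scaleC_scaleC: "a *\<^sub>C (b *\<^sub>C x) = (a * b) *\<^sub>C x"
    and scaleC_one: "1 *\<^sub>C x = x"
    and scaleR_eq_scaleC: "r *\<^sub>R x = complex_of_real r *\<^sub>C x"
    and norm_scaleC: "norm (a *\<^sub>C x) = cmod a * norm x"

lemma vector_space_scaleC:
  "vector_space (scaleC :: complex \<Rightarrow> 'a \<Rightarrow> 'a::complex_banach)"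
  by unfold_locales (simp_all add: scaleC_add_right scaleC_add_left scaleC_scaleC scaleC_one)

definition infinite_dimensional :: "'a::complex_banach itself \<Rightarrow> bool" where
  "infinite_dimensional _ \<longleftrightarrow>
     \<not> (\<exists>B :: 'a set. finite_dimensional_vector_space scaleC B)"

text \<open>
  The power \<open>X\<^sup>m\<close> is the extensional function space \<open>{..<m} \<rightarrow>\<^sub>E UNIV\<close>, so that
  the entries of a tuple \<open>x\<close> are \<open>x 0, \<dots>, x (m - 1)\<close>, with the product topology.
\<close>

abbreviation power_topology :: "nat \<Rightarrow> (nat \<Rightarrow> 'a::complex_banach) topology" where
  "power_topology m \<equiv> product_topology (\<lambda>_. euclidean) {..<m}"

definition multilinear :: "nat \<Rightarrow> ((nat \<Rightarrow> 'a::complex_banach) \<Rightarrow> 'a) \<Rightarrow> bool" where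
  "multilinear m M \<longleftrightarrow>
     (\<forall>x \<in> {..<m} \<rightarrow>\<^sub>E UNIV. \<forall>i<m. Vector_Spaces.linear scaleC scaleC (\<lambda>v. M (x(i := v))))"

definition continuous_multilinear :: "nat \<Rightarrow> ((nat \<Rightarrow> 'a::complex_banach) \<Rightarrow> 'a) \<Rightarrow> bool" where
  "continuous_multilinear m M \<longleftrightarrow>
     multilinear m M \<and> continuous_map (power_topology m) euclidean M"

lemma restrict_fundef_cong [fundef_cong]:
  "A = B \<Longrightarrow> (\<And>i. i \<in> B \<Longrightarrow> f i = g i) \<Longrightarrow> restrict f A = restrict g B"
  by (auto simp: restrict_def)

text \<open>
  The sequence \<open>(x\<^sub>n)\<close>, \<open>n \<ge> 1 - m\<close>, is indexed here by \<open>k = n + m - 1 \<ge> 0\<close>: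
  the indices \<open>k < m\<close> carry the initial conditions \<open>x\<^bsub>1-m\<^esub>, \<dots>, x\<^sub>0\<close>, and for \<open>k \<ge> m\<close> the
  term is \<open>M\<close> applied to the \<open>m\<close> preceding terms, oldest first.
\<close>

function orbit_seq ::
  "nat \<Rightarrow> ((nat \<Rightarrow> 'a::complex_banach) \<Rightarrow> 'a) \<Rightarrow> (nat \<Rightarrow> 'a) \<Rightarrow> nat \<Rightarrow> 'a"
where
  "orbit_seq m M x k =
     (if k < m then x k else M (\<lambda>i\<in>{..<m}. orbit_seq m M x (k - m + i)))"
  by pat_completeness auto
termination
  by (relation "Wellfounded.measure (\<lambda>(m, M, x, k). k)") auto

declare orbit_seq.simps [simp del]

definition Orb :: "nat \<Rightarrow> ((nat \<Rightarrow> 'a::complex_banach) \<Rightarrow> 'a) \<Rightarrow> (nat \<Rightarrow> 'a) \<Rightarrow> 'a set" where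
  "Orb m M x = range (orbit_seq m M x)"

definition hypercyclic :: "nat \<Rightarrow> ((nat \<Rightarrow> 'a::complex_banach) \<Rightarrow> 'a) \<Rightarrow> bool" where
  "hypercyclic m M \<longleftrightarrow> (\<exists>x \<in> {..<m} \<rightarrow>\<^sub>E UNIV. closure (Orb m M x) = UNIV)"

end

theory Submission
  imports Defs "HOL-Real_Asymp.Real_Asymp"
begin

text \<open>
  Choose \<open>v\<^sub>0, v\<^sub>1, \<dots>\<close> with dense span, biorthogonal to functionals of at most exponential size
  after normalisation, and scaled so that \<open>\<parallel>v\<^sub>i\<parallel>\<close> grows like \<open>4\<^bsup>i\<^sup>2\<^esup>\<close>. Any map of the \<open>v\<^sub>i\<close> that is
  compatible with this growth extends to a bounded (nuclear) operator.

  For \<open>m = 1\<close> let \<open>T\<close> be the identity plus a nuclear operator, acting on the span as the translation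
  \<open>p(t) \<mapsto> p(t + 1)\<close> acts on polynomials, with \<open>v\<^sub>i\<close> in the role of \<open>t\<^sup>i\<close>. Polynomials with prescribed
  behaviour near \<open>0\<close> and near \<open>N\<close> have small higher coefficients for large \<open>N\<close>; hence \<open>T\<close> is
  topologically transitive and the Baire category theorem gives a dense orbit.

  For \<open>m \<ge> 2\<close> let \<open>N\<close> be the backward shift \<open>v\<^bsub>i+1\<^esub> \<mapsto> v\<^sub>i\<close>, let \<open>f\<close> be the coefficient functional of \<open>v\<^sub>0\<close>,
  and let \<open>M(u\<^sub>1, \<dots>, u\<^sub>m) = f(u\<^sub>1) \<cdots> f(u\<^bsub>m-1\<^esub>) N u\<^sub>m\<close>. The values \<open>s\<^sub>t\<close> of \<open>f\<close> along an orbit are arbitrary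
  nonzero numbers subject only to a convergence condition, and they determine the orbit. They are
  chosen in blocks, each of which makes one orbit term approximate a given target. The scalars
  multiplying the starting vector grow like products of previous values of \<open>s\<close>, so they can be made to
  outgrow the norms of the \<open>v\<^sub>i\<close>; then later blocks do not disturb earlier ones.
\<close>

section \<open>Norming functionals\<close>

text \<open>Positive homogeneity is required only as an inequality, which infima pass on directly;
  scaling back by \<open>inverse t\<close> gives equality.\<close>

definition sublinear :: "('a::real_vector \<Rightarrow> real) \<Rightarrow> bool" where
  "sublinear q \<longleftrightarrow> (\<forall>x y. q (x + y) \<le> q x + q y) \<and> (\<forall>t x. 0 < t \<longrightarrow> q (t *\<^sub>R x) \<le> t * q x)"

lemma sublinear_add: "sublinear q \<Longrightarrow> q (x + y) \<le> q x + q y"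
  by (simp add: sublinear_def)

lemma sublinear_scale_le: "sublinear q \<Longrightarrow> 0 < t \<Longrightarrow> q (t *\<^sub>R x) \<le> t * q x"
  by (simp add: sublinear_def)

lemma sublinear_scale:
  assumes q: "sublinear q" and t: "0 < t"
  shows "q (t *\<^sub>R x) = t * q x"
proof -
  have "q (inverse t *\<^sub>R t *\<^sub>R x) \<le> inverse t * q (t *\<^sub>R x)"
    using sublinear_scale_le[OF q, of "inverse t" "t *\<^sub>R x"] t by simp
  then have "t * q x \<le> q (t *\<^sub>R x)"
    using t by (simp add: field_simps)
  then show ?thesis
    using sublinear_scale_le[OF q t, of x] by simp
qed

lemma sublinear_zero:
  assumes "sublinear q" shows "q 0 = 0"
  using sublinear_scale[OF assms, of 2 0] by simp

lemma sublinear_uminus: "sublinear q \<Longrightarrow> - q (- x) \<le> q x"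
  using sublinear_add[of q x "- x"] sublinear_zero[of q] by simp

lemma sublinear_norm: "sublinear (norm :: 'a::real_normed_vector \<Rightarrow> real)"
  by (auto simp: sublinear_def norm_triangle_ineq)

text \<open>Hence a minimal sublinear functional is odd, and therefore linear.\<close>

lemma sublinear_decrease:
  assumes q: "sublinear q"
  shows "\<exists>q'. sublinear q' \<and> (\<forall>x. q' x \<le> q x) \<and> q' (- e) \<le> - q e"
proof -
  \<comment> \<open>The infimum of \<open>g x t\<close> over \<open>t\<close> pulls \<open>q\<close>
    down along \<open>- e\<close>: \<open>t = 0\<close> gives \<open>q' \<le> q\<close>, and
    \<open>t = 1\<close> at \<open>- e\<close> gives \<open>q 0 - q e = - q e\<close>.\<close>
  define g where "g x t = q (x + t *\<^sub>R e) - t * q e" for x t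
  define q' where "q' x = (INF t\<in>{0..}. g x t)" for x
  have lower: "- q (- x) \<le> g x t" if "t \<ge> 0" for x t
  proof -
    have "q (t *\<^sub>R e) \<le> q (x + t *\<^sub>R e) + q (- x)"
      using sublinear_add[OF q, of "x + t *\<^sub>R e" "- x"] by simp
    moreover have "q (t *\<^sub>R e) = t * q e"
      using that sublinear_scale[OF q, of t e] sublinear_zero[OF q] by (cases "t = 0") auto
    ultimately show ?thesis by (simp add: g_def)
  qed
  have bdd: "bdd_below (g x ` {0..})" for x
    using lower by (intro bdd_belowI2[of _ "- q (- x)"]) auto
  have le: "q' x \<le> g x t" if "t \<ge> 0" for x t
    unfolding q'_def using that by (intro cINF_lower bdd) auto
  have add: "q' (x + y) \<le> q' x + q' y" for x y
  proof -
    have "q' (x + y) - g y s \<le> q' x" if s: "s \<ge> 0" for s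
      unfolding q'_def[of x]
    proof (rule cINF_greatest)
      fix t :: real assume t: "t \<in> {0..}"
      have "q ((x + y) + (s + t) *\<^sub>R e) \<le> q (x + t *\<^sub>R e) + q (y + s *\<^sub>R e)"
        using sublinear_add[OF q, of "x + t *\<^sub>R e" "y + s *\<^sub>R e"]
        by (simp add: algebra_simps)
      then have "g (x + y) (s + t) \<le> g x t + g y s"
        by (simp add: g_def algebra_simps)
      then show "q' (x + y) - g y s \<le> g x t"
        using le[of "s + t" "x + y"] s t by auto
    qed auto
    then have "q' (x + y) - q' x \<le> q' y"
      unfolding q'_def[of y] by (intro cINF_greatest) (auto simp: algebra_simps)
    then show ?thesis by simp
  qed
  have scale: "q' (c *\<^sub>R x) \<le> c * q' x" if c: "0 < c" for c x
  proof -
    have "q' (c *\<^sub>R x) / c \<le> q' x"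
      unfolding q'_def[of x]
    proof (rule cINF_greatest)
      fix t :: real assume t: "t \<in> {0..}"
      have "g (c *\<^sub>R x) (c * t) = c * g x t"
        using sublinear_scale[OF q c, of "x + t *\<^sub>R e"] by (simp add: g_def algebra_simps)
      then show "q' (c *\<^sub>R x) / c \<le> g x t"
        using le[of "c * t" "c *\<^sub>R x"] c t by (simp add: field_simps)
    qed auto
    then show ?thesis using c by (simp add: field_simps)
  qed
  have "q' x \<le> q x" for x
    using le[of 0 x] by (simp add: g_def)
  moreover have "q' (- e) \<le> - q e"
    using le[of 1 "- e"] sublinear_zero[OF q] by (simp add: g_def)
  ultimately show ?thesis
    using add scale by (intro exI[of _ q'] conjI) (auto simp: sublinear_def)
qed

text \<open>Zorn's lemma for the reversed pointwise order. The pointwise infimum of a chain is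
  finite because every member lies above \<open>- p (- x)\<close>.\<close>

lemma minimal_sublinear:
  assumes p: "sublinear p"
  shows "\<exists>q. sublinear q \<and> (\<forall>x. q x \<le> p x) \<and>
    (\<forall>r. sublinear r \<longrightarrow> (\<forall>x. r x \<le> q x) \<longrightarrow> r = q)"
proof -
  define A where "A = {q. sublinear q \<and> q \<le> p}"
  have "\<exists>m\<in>A. \<forall>a\<in>A. a \<le> m \<longrightarrow> a = m"
  proof (rule predicate_Zorn)
    show "partial_order_on A (relation_of (\<lambda>x y. y \<le> x) A)"
      by (auto simp: partial_order_on_def preorder_on_def refl_on_def trans_def antisym_def
          relation_of_def)
  next
    fix C assume "C \<in> Chains (relation_of (\<lambda>x y. y \<le> x) A)"
    then have C: "C \<subseteq> A" "\<And>a b. a \<in> C \<Longrightarrow> b \<in> C \<Longrightarrow> a \<le> b \<or> b \<le> a"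
      by (auto simp: Chains_def relation_of_def)
    show "\<exists>u\<in>A. \<forall>a\<in>C. u \<le> a"
    proof (cases "C = {}")
      case True
      then show ?thesis using p by (auto simp: A_def)
    next
      case False
      define u where "u x = (INF q\<in>C. q x)" for x
      have sub: "sublinear q" "q x \<le> p x" if "q \<in> C" for q x
        using that C(1) by (auto simp: A_def le_fun_def)
      have bdd: "bdd_below ((\<lambda>q. q x) ` C)" for x
      proof (rule bdd_belowI2)
        fix q assume "q \<in> C"
        then show "- p (- x) \<le> q x"
          using sublinear_uminus[OF sub(1), of q x] sub(2)[of q "- x"] by simp
      qed
      have le: "u x \<le> q x" if "q \<in> C" for q x
        unfolding u_def using that by (intro cINF_lower bdd)
      have add: "u (x + y) \<le> u x + u y" for x y
      proof -
        have "u (x + y) - q2 y \<le> u x" if q2: "q2 \<in> C" for q2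
          unfolding u_def[of x]
        proof (rule cINF_greatest[OF False])
          fix q1 assume q1: "q1 \<in> C"
          \<comment> \<open>The smaller of the two chain members serves for \<open>x\<close> and
            \<open>y\<close> at once.\<close>
          obtain q where q: "q \<in> C" "q \<le> q1" "q \<le> q2"
            using C(2)[OF q1 q2] q1 q2 by auto
          show "u (x + y) - q2 y \<le> q1 x"
            using le[OF q(1), of "x + y"] sublinear_add[OF sub(1)[OF q(1)], of x y] q(2,3)
            by (smt (verit) le_funD)
        qed
        then have "u (x + y) - u x \<le> u y"
          unfolding u_def[of y] by (intro cINF_greatest False) (auto simp: algebra_simps)
        then show ?thesis by simp
      qed
      have scale: "u (c *\<^sub>R x) \<le> c * u x" if c: "0 < c" for c x
      proof -
        have "u (c *\<^sub>R x) / c \<le> u x"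
          unfolding u_def[of x]
        proof (rule cINF_greatest[OF False])
          fix q assume q: "q \<in> C"
          show "u (c *\<^sub>R x) / c \<le> q x"
            using le[OF q, of "c *\<^sub>R x"] sublinear_scale[OF sub(1)[OF q] c, of x] c
            by (simp add: field_simps)
        qed
        then show ?thesis using c by (simp add: field_simps)
      qed
      obtain q0 where q0: "q0 \<in> C" using False by blast
      have "u \<in> A"
        using add scale order_trans[OF le[OF q0] sub(2)[OF q0]]
        by (auto simp: A_def sublinear_def le_fun_def)
      then show ?thesis using le by (auto simp: le_fun_def)
    qed
  qed
  then obtain q where q: "q \<in> A" "\<And>a. a \<in> A \<Longrightarrow> a \<le> q \<Longrightarrow> a = q" by blast
  have "r = q" if "sublinear r" "\<forall>x. r x \<le> q x" for r
    using q that by (intro q(2)) (auto simp: A_def le_fun_def intro: order_trans)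
  then show ?thesis using q(1) by (auto simp: A_def le_fun_def)
qed

text \<open>Hahn-Banach by minimality. Lowering the norm at \<open>- e\<close> before passing to a
  minimal functional forces \<open>f e = - f (- e) \<ge> norm e\<close>.\<close>

lemma norming_real_functional:
  fixes e :: "'a::real_normed_vector"
  shows "\<exists>f. linear f \<and> (\<forall>x. f x \<le> norm x) \<and> f e = norm e"
proof -
  obtain p where p: "sublinear p" "\<And>x. p x \<le> norm x" "p (- e) \<le> - norm e"
    using sublinear_decrease[OF sublinear_norm, of e] by blast
  obtain f where f: "sublinear f" "\<And>x. f x \<le> p x"
    and min: "\<And>r. sublinear r \<Longrightarrow> \<forall>x. r x \<le> f x \<Longrightarrow> r = f"
    using minimal_sublinear[OF p(1)] by blast
  have neg: "f (- x) = - f x" for x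
  proof -
    obtain r where "sublinear r" "\<forall>y. r y \<le> f y" "r (- x) \<le> - f x"
      using sublinear_decrease[OF f(1), of x] by blast
    then have "f (- x) \<le> - f x" using min by blast
    then show ?thesis using sublinear_uminus[OF f(1), of x] by simp
  qed
  have lin: "linear f"
  proof (rule linearI)
    fix x y
    show "f (x + y) = f x + f y"
      using sublinear_add[OF f(1), of x y] sublinear_add[OF f(1), of "x + y" "- y"] neg[of y]
      by simp
  next
    fix t :: real and x
    consider "t > 0" | "t = 0" | "t < 0" by linarith
    then show "f (t *\<^sub>R x) = t *\<^sub>R f x"
    proof cases
      case 1 then show ?thesis using sublinear_scale[OF f(1)] by simp
    next
      case 2 then show ?thesis using sublinear_zero[OF f(1)] by simp
    next
      case 3
      then show ?thesis
        using sublinear_scale[OF f(1), of "- t" "- x"] neg[of x] by simp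
    qed
  qed
  have "f x \<le> norm x" for x using f(2) p(2) order_trans by blast
  moreover have "f e \<ge> norm e" using neg[of e] f(2)[of "- e"] p(3) by simp
  ultimately show ?thesis using lin by (auto intro!: exI[of _ f] antisym)
qed

section \<open>Complex-linear functionals and operators\<close>

interpretation cvs: vector_space "scaleC :: complex \<Rightarrow> 'a \<Rightarrow> 'a::complex_banach"
  by (rule vector_space_scaleC)

definition clinear_functional :: "('a::complex_banach \<Rightarrow> complex) \<Rightarrow> bool" where
  "clinear_functional f \<longleftrightarrow> bounded_linear f \<and> (\<forall>c x. f (c *\<^sub>C x) = c * f x)"

definition clinear_operator :: "('a::complex_banach \<Rightarrow> 'a) \<Rightarrow> bool" where
  "clinear_operator T \<longleftrightarrow> bounded_linear T \<and> (\<forall>c x. T (c *\<^sub>C x) = c *\<^sub>C T x)"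

lemma bounded_bilinear_scaleC: "bounded_bilinear (scaleC :: complex \<Rightarrow> 'a \<Rightarrow> 'a::complex_banach)"
proof
  fix a a' r and b b' :: 'a
  show "(a + a') *\<^sub>C b = a *\<^sub>C b + a' *\<^sub>C b" by (rule scaleC_add_left)
  show "a *\<^sub>C (b + b') = a *\<^sub>C b + a *\<^sub>C b'" by (rule scaleC_add_right)
  show "(r *\<^sub>R a) *\<^sub>C b = r *\<^sub>R a *\<^sub>C b"
    by (simp add: scaleR_eq_scaleC scaleC_scaleC scaleR_conv_of_real)
  show "a *\<^sub>C r *\<^sub>R b = r *\<^sub>R a *\<^sub>C b"
    by (simp add: scaleR_eq_scaleC scaleC_scaleC mult.commute)
  show "\<exists>K. \<forall>a (b :: 'a). norm (a *\<^sub>C b) \<le> norm a * norm b * K"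
    by (rule exI[of _ 1]) (simp add: norm_scaleC)
qed

interpretation scaleC: bounded_bilinear "scaleC :: complex \<Rightarrow> 'a \<Rightarrow> 'a::complex_banach"
  by (rule bounded_bilinear_scaleC)

text \<open>The usual complexification \<open>g x - \<i> * g (\<i> *\<^sub>C x)\<close> of a real
  norming functional \<open>g\<close>.\<close>

lemma norming_functional:
  fixes e :: "'a::complex_banach"
  shows "\<exists>f. clinear_functional f \<and> (\<forall>x. cmod (f x) \<le> norm x) \<and> f e = norm e"
proof -
  obtain g where g: "linear g" "\<And>x. g x \<le> norm x" "g e = norm e"
    using norming_real_functional[of e] by blast
  interpret linear g by fact
  define f where "f x = Complex (g x) (- g (\<i> *\<^sub>C x))" for x
  have real: "g (of_real r *\<^sub>C x) = r * g x" for r x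
    using scale[of r x] by (simp add: scaleR_eq_scaleC)
  have hom: "f (c *\<^sub>C x) = c * f x" for c x
  proof -
    have *: "g (c *\<^sub>C y) = Re c * g y + Im c * g (\<i> *\<^sub>C y)" for y
    proof -
      have "c *\<^sub>C y = of_real (Re c) *\<^sub>C y + of_real (Im c) *\<^sub>C \<i> *\<^sub>C y"
        by (simp add: scaleC_scaleC flip: scaleC_add_left)
          (metis complex_eq mult.commute)
      then have "g (c *\<^sub>C y) = g (of_real (Re c) *\<^sub>C y) + g (of_real (Im c) *\<^sub>C \<i> *\<^sub>C y)"
        by (simp only: add)
      then show ?thesis by (simp only: real)
    qed
    have "\<i> *\<^sub>C c *\<^sub>C x = c *\<^sub>C \<i> *\<^sub>C x" by (simp add: scaleC_scaleC mult.commute)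
    moreover have "g (\<i> *\<^sub>C \<i> *\<^sub>C x) = - g x"
      using real[of "-1" x] by (simp add: scaleC_scaleC)
    ultimately have "g (\<i> *\<^sub>C c *\<^sub>C x) = Re c * g (\<i> *\<^sub>C x) - Im c * g x"
      by (simp only: *)
    then show ?thesis
      unfolding f_def by (simp add: complex_eq_iff *[of x])
  qed
  have bound: "cmod (f x) \<le> norm x" for x
  proof (cases "f x = 0")
    case False
    \<comment> \<open>Multiplying by the unimodular \<open>c\<close> makes the value real; there it
      equals that of \<open>g\<close>, to which the real bound applies.\<close>
    define c where "c = cnj (sgn (f x))"
    have "c * f x = of_real (cmod (f x))"
      using complex_norm_square[of "f x"] False
      by (simp add: c_def sgn_eq power2_eq_square field_simps)
    then have "f (c *\<^sub>C x) = of_real (cmod (f x))" by (simp add: hom)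
    then have "cmod (f x) = g (c *\<^sub>C x)" by (metis Re_complex_of_real complex.sel(1) f_def)
    also have "\<dots> \<le> norm (c *\<^sub>C x)" by (rule g)
    also have "\<dots> = norm x" using False by (simp add: norm_scaleC c_def norm_sgn)
    finally show ?thesis .
  qed simp
  have "bounded_linear f"
  proof (rule bounded_linear_intro[where K = 1])
    show "f (x + y) = f x + f y" for x y
      by (simp add: f_def add scaleC_add_right complex_eq_iff)
    show "f (r *\<^sub>R x) = r *\<^sub>R f x" for r x
      by (simp add: scaleR_eq_scaleC hom scaleR_conv_of_real)
  qed (use bound in auto)
  moreover have "f e = norm e"
  proof -
    have "Re (f e) = norm e" by (simp add: f_def g)
    \<comment> \<open>The real part already has size \<open>norm e\<close>, so the bound on the
      modulus leaves no room for an imaginary part.\<close>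
    moreover have "(Re (f e))\<^sup>2 + (Im (f e))\<^sup>2 \<le> (norm e)\<^sup>2"
      using bound[of e] by (simp flip: cmod_power2 add: power_mono)
    ultimately show ?thesis by (simp add: complex_eq_iff)
  qed
  ultimately show ?thesis
    using hom bound by (intro exI[of _ f]) (auto simp: clinear_functional_def)
qed

section \<open>Biorthogonal systems and nuclear operators\<close>

lemma clinear_functional_scale: "clinear_functional f \<Longrightarrow> f (c *\<^sub>C x) = c * f x"
  and clinear_functional_bounded: "clinear_functional f \<Longrightarrow> bounded_linear f"
  by (auto simp: clinear_functional_def)

lemma clinear_operator_scale: "clinear_operator T \<Longrightarrow> T (c *\<^sub>C x) = c *\<^sub>C T x"
  and clinear_operator_bounded: "clinear_operator T \<Longrightarrow> bounded_linear T"
  by (auto simp: clinear_operator_def)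

definition biorthogonal :: "(nat \<Rightarrow> 'a::complex_banach) \<Rightarrow> (nat \<Rightarrow> 'a \<Rightarrow> complex) \<Rightarrow> bool" where
  "biorthogonal e f \<longleftrightarrow> (\<forall>n. norm (e n) = 1 \<and> clinear_functional (f n) \<and>
     (\<forall>x. cmod (f n x) \<le> 2 ^ n * norm x) \<and> (\<forall>k. f n (e k) = (if k = n then 1 else 0)))"

text \<open>
  Subtracting from a norming functional of \<open>e\<^sub>n\<close> its values on \<open>e\<^sub>0, \<dots>, e\<^bsub>n-1\<^esub>\<close> at most doubles
  the bounds of the biorthogonal functionals, so no finer selection is needed.
\<close>

lemma biorthogonal_step:
  fixes e :: "nat \<Rightarrow> 'a::complex_banach"
  assumes unit: "\<And>k. k < n \<Longrightarrow> norm (e k) = 1"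
    and cf: "\<And>k. k < n \<Longrightarrow> clinear_functional (f k)"
    and bd: "\<And>k x. k < n \<Longrightarrow> cmod (f k x) \<le> 2 ^ k * norm x"
    and bi: "\<And>k j. k < n \<Longrightarrow> j < n \<Longrightarrow> f k (e j) = (if j = k then 1 else 0)"
    and inf: "infinite_dimensional TYPE('a)"
  shows "\<exists>e' f'. norm e' = 1 \<and> clinear_functional f' \<and> (\<forall>x. cmod (f' x) \<le> 2 ^ n * norm x) \<and>
    f' e' = 1 \<and> (\<forall>k<n. f' (e k) = 0 \<and> f k e' = 0) \<and>
    d = (\<Sum>k<n. f k d *\<^sub>C e k) + f' d *\<^sub>C e'"
proof -
  define P where "P x = (\<Sum>k<n. f k x *\<^sub>C e k)" for x
  have "\<exists>x. P x \<noteq> x"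
  proof (rule ccontr)
    assume "\<nexists>x. P x \<noteq> x"
    moreover have "P x \<in> cvs.span (e ` {..<n})" for x
      unfolding P_def by (intro cvs.span_sum cvs.span_scale cvs.span_base) auto
    ultimately have "cvs.span (e ` {..<n}) = UNIV" by (metis UNIV_eq_I)
    moreover obtain B where B: "B \<subseteq> e ` {..<n}" "cvs.independent B" "e ` {..<n} \<subseteq> cvs.span B"
      using cvs.maximal_independent_subset[of "e ` {..<n}"] by blast
    ultimately have "cvs.span B = UNIV"
      by (metis cvs.span_mono cvs.span_span top.extremum_uniqueI)
    moreover have "finite B" using B(1) finite_subset by blast
    ultimately have "finite_dimensional_vector_space (scaleC :: complex \<Rightarrow> 'a \<Rightarrow> 'a) B"
      using B(2) by unfold_locales auto
    then show False using inf by (auto simp: infinite_dimensional_def)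
  qed
  \<comment> \<open>The new direction comes from \<open>d\<close> itself when \<open>d\<close> is
    outside the span of the earlier vectors, so \<open>d\<close> always lies in the enlarged
    span.\<close>
  then obtain x where x: "P x \<noteq> x" "P d = d \<or> x = d" by metis
  define e' where "e' = (1 / norm (x - P x)) *\<^sub>R (x - P x)"
  have e': "norm e' = 1" using x(1) by (simp add: e'_def)
  have lin: "f k (y + z) = f k y + f k z" "f k (y - z) = f k y - f k z"
    "f k (\<Sum>i\<in>I. h i) = (\<Sum>i\<in>I. f k (h i))" "f k (r *\<^sub>R y) = r *\<^sub>R f k y"
    if "k < n" for k y z r and h :: "nat \<Rightarrow> 'a" and I
  proof -
    interpret bounded_linear "f k" using cf that by (simp add: clinear_functional_def)
    show "f k (y + z) = f k y + f k z" "f k (y - z) = f k y - f k z"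
      "f k (\<Sum>i\<in>I. h i) = (\<Sum>i\<in>I. f k (h i))" "f k (r *\<^sub>R y) = r *\<^sub>R f k y"
      by (simp_all add: add diff sum scaleR)
  qed
  have fP: "f k (P y) = f k y" if "k < n" for k y
  proof -
    have "f k (P y) = (\<Sum>j<n. f j y * (if j = k then 1 else 0))"
      unfolding P_def using that by (simp add: lin clinear_functional_scale[OF cf] bi)
    also have "\<dots> = f k y" using that by (simp add: sum.delta if_distrib cong: if_cong)
    finally show ?thesis .
  qed
  have fe': "f k e' = 0" if "k < n" for k
    using that by (simp add: e'_def lin fP)
  obtain g where g: "clinear_functional g" "\<And>x. cmod (g x) \<le> norm x" "g e' = 1"
    using norming_functional[of e'] e' by auto
  interpret g: bounded_linear g using g(1) by (simp add: clinear_functional_def)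
  \<comment> \<open>The correction cancels \<open>g (e k)\<close> at each \<open>e k\<close> and
    leaves the value at \<open>e'\<close> alone because \<open>f k e' = 0\<close>.\<close>
  define f' where "f' y = g y - (\<Sum>k<n. g (e k) * f k y)" for y
  have cf': "clinear_functional f'"
    unfolding clinear_functional_def
  proof (intro conjI allI)
    show "bounded_linear f'"
      unfolding f'_def using cf
      by (intro bounded_linear_sub bounded_linear_sum bounded_linear_const_mult g.bounded_linear_axioms)
        (auto simp: clinear_functional_def)
    show "f' (c *\<^sub>C y) = c * f' y" for c y
      by (simp add: f'_def clinear_functional_scale[OF g(1)] clinear_functional_scale[OF cf]
          sum_distrib_left algebra_simps)
  qed
  have bd': "cmod (f' y) \<le> 2 ^ n * norm y" for y
  proof -
    have "cmod (f' y) \<le> cmod (g y) + cmod (\<Sum>k<n. g (e k) * f k y)"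
      unfolding f'_def by (rule norm_triangle_ineq4)
    also have "\<dots> \<le> norm y + (\<Sum>k<n. 1 * (2 ^ k * norm y))"
    proof (intro add_mono g(2) sum_norm_le)
      fix k assume "k \<in> {..<n}"
      then have "cmod (g (e k)) * cmod (f k y) \<le> 1 * (2 ^ k * norm y)"
        using g(2)[of "e k"] unit[of k] bd[of k y] by (intro mult_mono) auto
      then show "cmod (g (e k) * f k y) \<le> 1 * (2 ^ k * norm y)" by (simp add: norm_mult)
    qed
    also have "\<dots> = (1 + (\<Sum>k<n. 2 ^ k)) * norm y" by (simp add: sum_distrib_left algebra_simps)
    also have "1 + (\<Sum>k<n. 2 ^ k) = (2 ^ n :: real)" by (induction n) auto
    finally show ?thesis .
  qed
  have f'e: "f' (e k) = 0" if "k < n" for k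
  proof -
    have "(\<Sum>j<n. g (e j) * f j (e k)) = (\<Sum>j<n. g (e j) * (if k = j then 1 else 0))"
      using that by (intro sum.cong) (auto simp: bi)
    also have "\<dots> = g (e k)" using that by (simp add: sum.delta if_distrib cong: if_cong)
    finally show ?thesis by (simp add: f'_def)
  qed
  have f'e': "f' e' = 1" using g(3) fe' by (simp add: f'_def)
  interpret f': bounded_linear f' using cf' by (simp add: clinear_functional_def)
  have f'P: "f' (P y) = 0" for y
    unfolding P_def by (simp add: f'.sum clinear_functional_scale[OF cf'] f'e)
  have "f' d *\<^sub>C e' = d - P d"
  proof (cases "P d = d")
    case True
    then show ?thesis using f'P[of d] by simp
  next
    case False
    then have "x = d" using x by blast
    have d: "d - P d = norm (d - P d) *\<^sub>R e'" using x(1) by (simp add: e'_def \<open>x = d\<close>)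
    have "f' d = f' (d - P d)" by (simp add: f'.diff f'P)
    also have "\<dots> = of_real (norm (d - P d))"
      by (subst d) (simp add: f'.scaleR f'e' scaleR_conv_of_real)
    finally show ?thesis using d by (simp add: scaleR_eq_scaleC)
  qed
  then have "d = P d + f' d *\<^sub>C e'" by simp
  then show ?thesis
    using e' cf' bd' f'e' f'e fe' unfolding P_def by blast
qed

lemma separable_dense_sequence:
  assumes "separable_space (euclidean :: 'a::metric_space topology)"
  shows "\<exists>d :: nat \<Rightarrow> 'a. \<forall>y \<epsilon>. 0 < \<epsilon> \<longrightarrow> (\<exists>i. dist (d i) y < \<epsilon>)"
proof -
  obtain D :: "'a set" where D: "countable D" "closure D = UNIV"
    using assms by (auto simp: separable_space_def)
  then have "D \<noteq> {}" by auto
  then have "range (from_nat_into D) = D" using D(1) by (rule range_from_nat_into)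
  moreover have "\<exists>z\<in>D. dist z y < \<epsilon>" if "0 < \<epsilon>" for y \<epsilon>
    using D(2) that closure_approachable[of y D] by blast
  ultimately show ?thesis by (intro exI[of _ "from_nat_into D"]) (metis imageE)
qed

text \<open>Recursion along a dense sequence \<open>d\<close>: each step puts \<open>d n\<close>
  into the span of the first \<open>n + 1\<close> vectors, so that the span is dense.\<close>

lemma biorthogonal_system:
  assumes sep: "separable_space (euclidean :: 'a::complex_banach topology)"
    and inf: "infinite_dimensional TYPE('a)"
  shows "\<exists>(e :: nat \<Rightarrow> 'a) f. biorthogonal e f \<and>
    (\<forall>y \<epsilon>. 0 < \<epsilon> \<longrightarrow> (\<exists>n a. norm (y - (\<Sum>k<n. a k *\<^sub>C e k)) < \<epsilon>))"
proof -
  obtain d :: "nat \<Rightarrow> 'a" where d: "\<And>y \<epsilon>. 0 < \<epsilon> \<Longrightarrow> \<exists>i. dist (d i) y < \<epsilon>"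
    using separable_dense_sequence[OF sep] by blast
  \<comment> \<open>A pair holds a vector and its functional. \<open>Q\<close> sees
    \<open>\<phi>\<close> only below \<open>n\<close>, as well-founded choice demands.\<close>
  define Q where "Q \<phi> n r \<longleftrightarrow> norm (fst r) = 1 \<and> clinear_functional (snd r) \<and>
    (\<forall>x. cmod (snd r x) \<le> 2 ^ n * norm x) \<and> snd r (fst r) = 1 \<and>
    (\<forall>k<n. snd r (fst (\<phi> k)) = 0 \<and> snd (\<phi> k) (fst r) = 0) \<and>
    d n = (\<Sum>k<n. snd (\<phi> k) (d n) *\<^sub>C fst (\<phi> k)) + snd r (d n) *\<^sub>C fst r"
    for \<phi> :: "nat \<Rightarrow> 'a \<times> ('a \<Rightarrow> complex)" and n r
  have "\<exists>\<phi>. \<forall>n. Q \<phi> n (\<phi> n)"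
  proof (rule dependent_wf_choice[OF wf_less_than])
    fix \<phi> \<psi> :: "nat \<Rightarrow> 'a \<times> ('a \<Rightarrow> complex)" and n r
    assume "\<And>k. (k, n) \<in> less_than \<Longrightarrow> \<phi> k = \<psi> k"
    then have "\<And>k. k < n \<Longrightarrow> \<phi> k = \<psi> k" by simp
    then show "Q \<phi> n r = Q \<psi> n r" unfolding Q_def by auto
  next
    fix n and \<phi> :: "nat \<Rightarrow> 'a \<times> ('a \<Rightarrow> complex)"
    assume "\<And>k. (k, n) \<in> less_than \<Longrightarrow> Q \<phi> k (\<phi> k)"
    then have Q: "Q \<phi> k (\<phi> k)" if "k < n" for k using that by simp
    have "snd (\<phi> k) (fst (\<phi> j)) = (if j = k then 1 else 0)" if "k < n" "j < n" for k j
      using Q[OF that(1)] Q[OF that(2)] by (auto simp: Q_def neq_iff)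
    then have "\<exists>e' f'. norm e' = 1 \<and> clinear_functional f' \<and> (\<forall>x. cmod (f' x) \<le> 2 ^ n * norm x) \<and>
      f' e' = 1 \<and> (\<forall>k<n. f' (fst (\<phi> k)) = 0 \<and> snd (\<phi> k) e' = 0) \<and>
      d n = (\<Sum>k<n. snd (\<phi> k) (d n) *\<^sub>C fst (\<phi> k)) + f' (d n) *\<^sub>C e'"
      using Q by (intro biorthogonal_step inf) (auto simp: Q_def)
    then show "\<exists>r. Q \<phi> n r" unfolding Q_def by auto
  qed
  then obtain \<phi> where \<phi>: "\<And>n. Q \<phi> n (\<phi> n)" by blast
  define e where "e n = fst (\<phi> n)" for n
  define f where "f n = snd (\<phi> n)" for n
  have "f n (e k) = (if k = n then 1 else 0)" for n k
    using \<phi>[of n] \<phi>[of k] by (auto simp: Q_def e_def f_def neq_iff)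
  then have "biorthogonal e f"
    using \<phi> by (auto simp: biorthogonal_def Q_def e_def f_def)
  moreover have "\<exists>n a. norm (y - (\<Sum>k<n. a k *\<^sub>C e k)) < \<epsilon>" if pos: "0 < \<epsilon>" for y \<epsilon>
  proof -
    obtain i where i: "dist (d i) y < \<epsilon>" using d[OF pos] by blast
    have "d i = (\<Sum>k<Suc i. f k (d i) *\<^sub>C e k)"
      using \<phi>[of i] by (simp add: Q_def e_def f_def)
    then have "norm (y - (\<Sum>k<Suc i. f k (d i) *\<^sub>C e k)) < \<epsilon>"
      using i by (simp only: dist_norm norm_minus_commute)
    then show ?thesis by (intro exI[of _ "Suc i"] exI[of _ "\<lambda>k. f k (d i)"])
  qed
  ultimately show ?thesis by blast
qed

section \<open>Nuclear operators and the weighted basis\<close>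

text \<open>The series of \<open>f i x *\<^sub>C g i\<close> converges absolutely, since the factor
  \<open>2 ^ i\<close> in the hypothesis matches the bound on \<open>f i\<close>.\<close>

lemma nuclear_operator:
  assumes bi: "biorthogonal e f" and g: "summable (\<lambda>i. 2 ^ i * norm (g i))"
  shows "\<exists>K. clinear_operator K \<and> (\<forall>i. K (e i) = g i)"
proof -
  have cf: "clinear_functional (f i)" and bd: "cmod (f i x) \<le> 2 ^ i * norm x"
    and fe: "f i (e k) = (if k = i then 1 else 0)" for i k x
    using bi by (auto simp: biorthogonal_def)
  have le: "norm (f i x *\<^sub>C g i) \<le> norm x * (2 ^ i * norm (g i))" for i x
    using mult_right_mono[OF bd[of i x], of "norm (g i)"] by (simp add: norm_scaleC algebra_simps)
  have sumn: "summable (\<lambda>i. norm (f i x *\<^sub>C g i))" for x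
    using le by (intro summable_comparison_test'[OF summable_mult[OF g, of "norm x"], of 0]) auto
  then have sum: "summable (\<lambda>i. f i x *\<^sub>C g i)" for x by (rule summable_norm_cancel)
  define K where "K x = (\<Sum>i. f i x *\<^sub>C g i)" for x
  have add: "K (x + y) = K x + K y" for x y
  proof -
    have "f i (x + y) = f i x + f i y" for i
      using cf[of i] by (simp add: clinear_functional_def linear_simps)
    then show ?thesis
      unfolding K_def by (simp add: suminf_add[OF sum sum] scaleC_add_left)
  qed
  have scale: "K (c *\<^sub>C x) = c *\<^sub>C K x" for c x
  proof -
    have "f i (c *\<^sub>C x) *\<^sub>C g i = c *\<^sub>C (f i x *\<^sub>C g i)" for i
      by (simp add: clinear_functional_scale[OF cf] scaleC_scaleC)
    then show ?thesis
      unfolding K_def by (simp only: bounded_linear.suminf[OF scaleC.bounded_linear_right sum])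
  qed
  have bound: "norm (K x) \<le> norm x * (\<Sum>i. 2 ^ i * norm (g i))" for x
  proof -
    have "norm (K x) \<le> (\<Sum>i. norm (f i x *\<^sub>C g i))"
      unfolding K_def by (rule summable_norm[OF sumn])
    also have "\<dots> \<le> (\<Sum>i. norm x * (2 ^ i * norm (g i)))"
      by (intro suminf_le le sumn summable_mult g)
    also have "\<dots> = norm x * (\<Sum>i. 2 ^ i * norm (g i))" by (rule suminf_mult[OF g])
    finally show ?thesis .
  qed
  have "bounded_linear K"
    by (rule bounded_linear_intro[OF add _ bound]) (simp add: scaleR_eq_scaleC scale)
  moreover have "K (e i) = g i" for i
  proof -
    have "(\<lambda>j. f j (e i) *\<^sub>C g j) sums (\<Sum>j\<in>{i}. f j (e i) *\<^sub>C g j)"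
      by (intro sums_finite) (auto simp: fe)
    then show ?thesis by (simp add: K_def fe sums_unique[symmetric] scaleC_one)
  qed
  ultimately show ?thesis using scale by (auto simp: clinear_operator_def)
qed

lemma shift_basis:
  assumes sep: "separable_space (euclidean :: 'a::complex_banach topology)"
    and inf: "infinite_dimensional TYPE('a)"
  obtains v :: "nat \<Rightarrow> 'a::complex_banach" and N f T
  where "\<And>i. norm (v i) \<le> 2 ^ (2 * i\<^sup>2)"
    "\<And>y \<epsilon>. 0 < \<epsilon> \<Longrightarrow> \<exists>n a. norm (y - (\<Sum>k<n. a k *\<^sub>C v k)) < \<epsilon>"
    "clinear_operator N" "N (v 0) = 0" "\<And>i. N (v (Suc i)) = v i"
    "clinear_functional f" "f (v 0) = 1" "\<And>i. f (v (Suc i)) = 0"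
    "clinear_operator T" "\<And>i. T (v i) = (\<Sum>l\<le>i. of_nat (i choose l) *\<^sub>C v l)"
proof -
  obtain e :: "nat \<Rightarrow> 'a" and f where bi: "biorthogonal e f"
    and dense: "\<And>y \<epsilon>. 0 < \<epsilon> \<Longrightarrow> \<exists>n a. norm (y - (\<Sum>k<n. a k *\<^sub>C e k)) < \<epsilon>"
    using biorthogonal_system[OF sep inf] by blast
  have e: "norm (e i) = 1" and cf: "clinear_functional (f i)"
    and fe: "f i (e k) = (if k = i then 1 else 0)" for i k
    using bi by (auto simp: biorthogonal_def)
  \<comment> \<open>Consecutive weights have ratio \<open>2 ^ (4 * i - 2)\<close>. Up to a constant
    this absorbs the factors \<open>2 ^ i\<close> of the functionals, of the binomial row sums and
    of the geometric majorant.\<close>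
  define c :: "nat \<Rightarrow> complex" where "c i = 2 ^ (2 * i\<^sup>2)" for i
  have c0: "c i \<noteq> 0" and cmod_c: "cmod (c i) = 2 ^ (2 * i\<^sup>2)" for i
    by (simp_all add: c_def norm_power)
  define v where "v i = c i *\<^sub>C e i" for i
  have ev: "e i = (1 / c i) *\<^sub>C v i" for i
    using c0[of i] by (simp add: v_def scaleC_scaleC scaleC_one)
  have nv: "norm (v i) = 2 ^ (2 * i\<^sup>2)" for i
    by (simp add: v_def norm_scaleC e cmod_c)
  have dense_v: "\<exists>n a. norm (y - (\<Sum>k<n. a k *\<^sub>C v k)) < \<epsilon>" if "0 < \<epsilon>" for y \<epsilon>
  proof -
    obtain n a where "norm (y - (\<Sum>k<n. a k *\<^sub>C e k)) < \<epsilon>" using dense[OF \<open>0 < \<epsilon>\<close>] by blast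
    then have "norm (y - (\<Sum>k<n. (a k / c k) *\<^sub>C v k)) < \<epsilon>" by (simp add: ev scaleC_scaleC)
    then show ?thesis by (intro exI[of _ n] exI[of _ "\<lambda>k. a k / c k"])
  qed
  define g where "g i = (if i = 0 then 0 else (1 / c i) *\<^sub>C v (i - 1))" for i
  have "2 ^ i * norm (g i) \<le> (1 / 2) ^ i" for i
  proof (cases i)
    case (Suc j)
    have "2 ^ i * norm (g i) * (2 ^ i * 2 ^ (2 * i\<^sup>2)) = 2 ^ i * 2 ^ i * 2 ^ (2 * j\<^sup>2)"
      using Suc by (simp add: g_def norm_scaleC norm_divide cmod_c nv)
    also have "\<dots> = 2 ^ (i + i + 2 * j\<^sup>2)" by (simp only: power_add)
    also have "\<dots> \<le> 2 ^ (2 * i\<^sup>2)" 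
      using Suc by (intro power_increasing) (auto simp: power2_eq_square)
    finally have "2 ^ i * norm (g i) * 2 ^ i \<le> 1" by (simp add: field_simps)
    then show ?thesis by (simp add: field_simps power_one_over)
  qed (simp add: g_def)
  then have "summable (\<lambda>i. 2 ^ i * norm (g i))"
    by (intro summable_comparison_test'[OF summable_geometric[of "1/2 :: real"], of 0]) auto
  then obtain N where N: "clinear_operator N" "\<And>i. N (e i) = g i"
    using nuclear_operator[OF bi] by blast
  have Nv: "N (v i) = c i *\<^sub>C g i" for i
    by (simp add: v_def clinear_operator_scale[OF N(1)] N(2))
  \<comment> \<open>Only the terms \<open>l < i\<close> are small against \<open>c i\<close>; the
    diagonal term is left to the identity in \<open>T\<close>.\<close>
  define h where "h i = (1 / c i) *\<^sub>C (\<Sum>l<i. of_nat (i choose l) *\<^sub>C v l)" for i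
  have "2 ^ i * norm (h i) \<le> 4 * (1 / 2) ^ i" for i
  proof (cases i)
    case (Suc j)
    have "norm (\<Sum>l<i. of_nat (i choose l) *\<^sub>C v l) \<le> (\<Sum>l<i. real (i choose l) * 2 ^ (2 * j\<^sup>2))"
    proof (rule sum_norm_le)
      fix l assume "l \<in> {..<i}"
      then have "l\<^sup>2 \<le> j\<^sup>2" using Suc by (intro power_mono) auto
      then show "norm (of_nat (i choose l) *\<^sub>C v l) \<le> real (i choose l) * 2 ^ (2 * j\<^sup>2)"
        by (auto simp: norm_scaleC nv intro!: mult_left_mono power_increasing)
    qed
    also have "\<dots> \<le> (\<Sum>l\<le>i. real (i choose l) * 2 ^ (2 * j\<^sup>2))"
      by (intro sum_mono2) auto
    also have "\<dots> = 2 ^ i * 2 ^ (2 * j\<^sup>2)"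
      by (simp flip: sum_distrib_right of_nat_sum add: choose_row_sum)
    finally have "norm (h i) * 2 ^ (2 * i\<^sup>2) \<le> 2 ^ i * 2 ^ (2 * j\<^sup>2)"
      by (simp add: h_def norm_scaleC norm_divide cmod_c)
    then have "2 ^ i * 2 ^ i * (norm (h i) * 2 ^ (2 * i\<^sup>2)) \<le> 2 ^ i * 2 ^ i * (2 ^ i * 2 ^ (2 * j\<^sup>2))"
      by (intro mult_left_mono) auto
    also have "\<dots> = 2 ^ (i + i + i + 2 * j\<^sup>2)" by (simp only: power_add mult.assoc)
    \<comment> \<open>The extra \<open>2\<close> in the exponent covers
      \<open>i = 1\<close>.\<close>
    also have "\<dots> \<le> 2 ^ (2 + 2 * i\<^sup>2)"
      using Suc by (intro power_increasing) (auto simp: power2_eq_square)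
    finally have "2 ^ i * 2 ^ i * norm (h i) \<le> 4" by (simp add: power_add field_simps)
    then show ?thesis by (simp add: field_simps power_one_over)
  qed (simp add: h_def)
  then have "summable (\<lambda>i. 2 ^ i * norm (h i))"
    by (intro summable_comparison_test'[OF summable_mult[OF summable_geometric[of "1/2 :: real"], of 4], of 0])
      auto
  then obtain K where K: "clinear_operator K" "\<And>i. K (e i) = h i"
    using nuclear_operator[OF bi] by blast
  have Kv: "K (v i) = (\<Sum>l<i. of_nat (i choose l) *\<^sub>C v l)" for i
    using c0[of i]
    by (simp add: v_def[of i] clinear_operator_scale[OF K(1)] K(2) h_def scaleC_scaleC scaleC_one)
  define T where "T x = x + K x" for x
  have "clinear_operator T"
    using K(1) bounded_linear_add[OF bounded_linear_ident, of K]
    by (simp add: clinear_operator_def T_def[abs_def] scaleC_add_right)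
  moreover have "T (v i) = (\<Sum>l\<le>i. of_nat (i choose l) *\<^sub>C v l)" for i
    by (simp add: T_def Kv scaleC_one flip: lessThan_Suc_atMost)
  moreover have "f 0 (v 0) = 1" "f 0 (v (Suc i)) = 0" for i
    by (simp_all add: v_def clinear_functional_scale[OF cf] fe c_def)
  moreover have "N (v 0) = 0" "N (v (Suc i)) = v i" for i
    using c0[of "Suc i"] by (simp_all add: Nv g_def scaleC_scaleC scaleC_one)
  ultimately show ?thesis
    using that[of v N "f 0" T] nv dense_v N(1) cf by simp
qed

section \<open>Linear operators\<close>

text \<open>Birkhoff's transitivity criterion: the points whose orbit meets a given ball form an
  open dense set, and the Baire category theorem intersects countably many of these.\<close>

lemma transitive_imp_dense_orbit:
  fixes T :: "'a::complete_space \<Rightarrow> 'a"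
  assumes sep: "separable_space (euclidean :: 'a topology)"
    and cont: "continuous_on UNIV T"
    and trans: "\<And>x y \<epsilon>. 0 < \<epsilon> \<Longrightarrow> \<exists>z n. dist z x < \<epsilon> \<and> dist ((T ^^ n) z) y < \<epsilon>"
  shows "\<exists>x. closure (range (\<lambda>n. (T ^^ n) x)) = UNIV"
proof -
  obtain d :: "nat \<Rightarrow> 'a" where d: "\<And>y \<epsilon>. 0 < \<epsilon> \<Longrightarrow> \<exists>i. dist (d i) y < \<epsilon>"
    using separable_dense_sequence[OF sep] by blast
  define G where "G i r = (\<Union>n. (T ^^ n) -` ball (d i) (1 / real (Suc r)))" for i r
  have contn: "continuous_on UNIV (T ^^ n)" for n
    by (induction n) (auto simp: id_def intro: continuous_on_compose2[OF cont])
  have "euclidean closure_of \<Inter> (range (\<lambda>(i, r). G i r)) = topspace (euclidean :: 'a topology)"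
  proof (rule Baire_category)
    show "completely_metrizable_space (euclidean :: 'a topology) \<or>
        locally_compact_space (euclidean :: 'a topology) \<and> regular_space (euclidean :: 'a topology)"
      using completely_metrizable_space_euclidean by blast
    show "countable (range (\<lambda>(i, r). G i r))"
      by (rule countable_image) (rule countableI_type)
    fix U assume "U \<in> range (\<lambda>(i, r). G i r)"
    then obtain i r where U: "U = G i r" by auto
    have "open U"
      unfolding U G_def using contn by (intro open_UN ballI open_vimage open_ball) auto
    moreover have "x \<in> closure U" for x
      unfolding closure_approachable
    proof (intro allI impI)
      fix \<epsilon> :: real assume \<epsilon>: "0 < \<epsilon>"
      obtain z n where "dist z x < min \<epsilon> (1 / real (Suc r))"
          "dist ((T ^^ n) z) (d i) < min \<epsilon> (1 / real (Suc r))"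
        using trans[of "min \<epsilon> (1 / real (Suc r))" x "d i"] \<epsilon> by auto
      then show "\<exists>y\<in>U. dist y x < \<epsilon>"
        unfolding U G_def by (intro bexI[of _ z]) (auto simp: dist_commute)
    qed
    ultimately show "openin euclidean U \<and> euclidean closure_of U = topspace euclidean"
      by auto
  qed
  then have "closure (\<Inter> (range (\<lambda>(i, r). G i r))) \<noteq> {}" by simp
  then obtain x where x: "\<And>i r. x \<in> G i r" by (fastforce simp: closure_eq_empty)
  have "y \<in> closure (range (\<lambda>n. (T ^^ n) x))" for y
    unfolding closure_approachable
  proof (intro allI impI)
    fix \<epsilon> :: real assume \<epsilon>: "0 < \<epsilon>"
    then obtain r where r: "1 / real (Suc r) < \<epsilon> / 2"
      using nat_approx_posE[of "\<epsilon> / 2"] by auto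
    obtain i where i: "dist (d i) y < \<epsilon> / 2" using d half_gt_zero[OF \<epsilon>] by blast
    obtain n where "dist (d i) ((T ^^ n) x) < 1 / real (Suc r)"
      using x[of i r] by (auto simp: G_def)
    then have "dist ((T ^^ n) x) y < \<epsilon>"
      using i r dist_triangle[of "(T ^^ n) x" y "d i"] by (simp add: dist_commute)
    then show "\<exists>z\<in>range (\<lambda>n. (T ^^ n) x). dist z y < \<epsilon>" by blast
  qed
  then show ?thesis by blast
qed

section \<open>Polynomials and coefficientwise limits\<close>

text \<open>Binomial theorem; the truncated difference \<open>i - l\<close> is harmless because
  \<open>i choose l\<close> vanishes for \<open>l > i\<close>.\<close>

lemma coeff_pcompose_translate:
  fixes p :: "'a::comm_semiring_1 poly"
  shows "coeff (pcompose p [:x, 1:]) l =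
    (\<Sum>i\<le>degree p. coeff p i * (of_nat (i choose l) * x ^ (i - l)))"
proof -
  have "pcompose p [:x, 1:] = (\<Sum>i\<le>degree p. smult (coeff p i) ([:x, 1:] ^ i))"
  proof -
    have "pcompose p [:x, 1:] = pcompose (\<Sum>i\<le>degree p. monom (coeff p i) i) [:x, 1:]"
      by (simp add: poly_as_sum_of_monoms)
    also have "\<dots> = (\<Sum>i\<le>degree p. smult (coeff p i) ([:x, 1:] ^ i))"
      unfolding pcompose_sum by (simp add: pcompose_altdef map_poly_monom poly_monom)
    finally show ?thesis .
  qed
  moreover have "coeff ([:x, 1:] ^ i) l = of_nat (i choose l) * x ^ (i - l)" for i
  proof (cases "l \<le> i")
    case False
    moreover have "degree ([:x, 1:] ^ i) \<le> i"
      using degree_power_le[of "[:x, 1:]" i] by simp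
    ultimately show ?thesis by (simp add: coeff_eq_0 binomial_eq_0)
  qed (simp add: coeff_linear_poly_power)
  ultimately show ?thesis by (simp add: coeff_sum)
qed

text \<open>The uniform degree bound keeps all sums finite, so this convergence is stable under
  products and carries over to vectors whatever the size of the basis vectors.\<close>

definition coeff_tendsto :: "(nat \<Rightarrow> complex poly) \<Rightarrow> complex poly \<Rightarrow> bool" where
  "coeff_tendsto r p \<longleftrightarrow> (\<exists>D. \<forall>n. degree (r n) \<le> D) \<and> (\<forall>i. (\<lambda>n. coeff (r n) i) \<longlonglongrightarrow> coeff p i)"

lemma coeff_tendsto_const: "coeff_tendsto (\<lambda>_. p) p"
  by (auto simp: coeff_tendsto_def)

lemma coeff_tendsto_add:
  assumes "coeff_tendsto r p" "coeff_tendsto s q"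
  shows "coeff_tendsto (\<lambda>n. r n + s n) (p + q)"
proof -
  obtain D E where "\<And>n. degree (r n) \<le> D" "\<And>n. degree (s n) \<le> E"
    using assms by (auto simp: coeff_tendsto_def)
  then have "\<And>n. degree (r n + s n) \<le> max D E"
    by (intro degree_add_le) (auto simp: le_max_iff_disj)
  then show ?thesis using assms by (auto simp: coeff_tendsto_def intro!: tendsto_add)
qed

lemma coeff_tendsto_mult:
  assumes "coeff_tendsto r p" "coeff_tendsto s q"
  shows "coeff_tendsto (\<lambda>n. r n * s n) (p * q)"
proof -
  obtain D E where "\<And>n. degree (r n) \<le> D" "\<And>n. degree (s n) \<le> E"
    using assms by (auto simp: coeff_tendsto_def)
  then have "\<And>n. degree (r n * s n) \<le> D + E"
    by (meson add_mono degree_mult_le order_trans)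
  then show ?thesis using assms
    by (auto simp: coeff_tendsto_def coeff_mult intro!: tendsto_sum tendsto_mult)
qed

text \<open>The \<open>i\<close>-th coefficient is divided by \<open>Suc n ^ i\<close>, so only the
  constant one survives.\<close>

lemma coeff_tendsto_rescale:
  "coeff_tendsto (\<lambda>n. pcompose p [:0, 1 / of_nat (Suc n):]) [:coeff p 0:]"
  unfolding coeff_tendsto_def
proof (intro conjI exI allI)
  fix n
  show "degree (pcompose p [:0, 1 / of_nat (Suc n):]) \<le> degree p"
    by (intro degree_le) (simp add: coeff_pcompose_linear coeff_eq_0)
next
  fix i
  show "(\<lambda>n. coeff (pcompose p [:0, 1 / of_nat (Suc n):]) i) \<longlonglongrightarrow> coeff [:coeff p 0:] i"
  proof (cases i)
    case 0
    then show ?thesis by (simp add: coeff_pcompose_linear del: coeff_pcompose_0)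
  next
    case (Suc j)
    have "(\<lambda>n. 1 / of_nat (Suc n) :: complex) \<longlonglongrightarrow> 0"
      using LIMSEQ_Suc[OF lim_1_over_n] by blast
    then have "(\<lambda>n. (1 / of_nat (Suc n)) ^ i * coeff p i) \<longlonglongrightarrow> 0 ^ i * coeff p i"
      by (intro tendsto_intros)
    then show ?thesis using Suc by (simp add: coeff_pcompose_linear)
  qed
qed

text \<open>With \<open>N = Suc n\<close>, the coefficients of the translate grow at most like
  \<open>N ^ degree q\<close>, which \<open>1 / N ^ k\<close> beats. Translations in both directions
  occur later, with \<open>c = 1\<close> and \<open>c = - 1\<close>.\<close>

lemma coeff_tendsto_damped_translate:
  assumes k: "degree q < k" and c: "cmod c = 1"
  shows "coeff_tendsto (\<lambda>n. smult (1 / of_nat (Suc n) ^ k) (pcompose q [:c * of_nat (Suc n), 1:])) 0"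
  unfolding coeff_tendsto_def
proof (intro conjI exI allI)
  fix n
  show "degree (smult (1 / of_nat (Suc n) ^ k) (pcompose q [:c * of_nat (Suc n), 1:])) \<le> degree q"
    using degree_pcompose_le[of q "[:c * of_nat (Suc n), 1:]"]
    by (auto intro: order_trans[OF degree_smult_le])
next
  fix l
  have lim: "(\<lambda>n. (c * of_nat (Suc n)) ^ j / of_nat (Suc n) ^ k) \<longlonglongrightarrow> 0" if "j < k" for j
  proof (rule Lim_null_comparison[OF _ LIMSEQ_Suc[OF lim_1_over_n]], intro always_eventually allI)
    fix n
    have "norm ((c * of_nat (Suc n)) ^ j / of_nat (Suc n) ^ k) = real (Suc n) ^ j / real (Suc n) ^ k"
      unfolding norm_divide norm_power norm_mult c norm_of_nat by simp
    also have "\<dots> = 1 / real (Suc n) ^ (k - j)"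
      using that by (simp add: power_diff)
    also have "\<dots> \<le> 1 / real (Suc n)"
      using that self_le_power[of "real (Suc n)" "k - j"] by (intro divide_left_mono) auto
    finally show "norm ((c * of_nat (Suc n)) ^ j / of_nat (Suc n) ^ k) \<le> 1 / of_nat (Suc n)" .
  qed
  have "(\<lambda>n. \<Sum>i\<le>degree q. coeff q i * of_nat (i choose l) *
      ((c * of_nat (Suc n)) ^ (i - l) / of_nat (Suc n) ^ k))
    \<longlonglongrightarrow> (\<Sum>i\<le>degree q. coeff q i * of_nat (i choose l) * 0)"
    using k by (intro tendsto_sum tendsto_mult tendsto_const lim) auto
  then show "(\<lambda>n. coeff (smult (1 / of_nat (Suc n) ^ k) (pcompose q [:c * of_nat (Suc n), 1:])) l)
      \<longlonglongrightarrow> coeff 0 l"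
    by (simp add: coeff_pcompose_translate sum_distrib_left sum_divide_distrib mult_ac del: of_nat_Suc)
qed

text \<open>With \<open>N = Suc n\<close>, the rescaled \<open>1 - U\<close> has the factor
  \<open>t ^ k / N ^ k\<close>. Handing \<open>1 / N ^ k\<close> to the translate of
  \<open>q\<close> kills the second summand, while the rescaled \<open>U\<close> tends to its value
  \<open>1\<close> at \<open>0\<close>.\<close>

lemma coeff_tendsto_blend:
  assumes U: "1 - U = monom 1 k * V" and k: "degree q < k" and c: "cmod c = 1"
  shows "coeff_tendsto (\<lambda>n. p * pcompose U [:0, 1 / of_nat (Suc n):] +
    pcompose q [:c * of_nat (Suc n), 1:] * (1 - pcompose U [:0, 1 / of_nat (Suc n):])) p"
proof -
  have "coeff (1 - U) 0 = 0" using k by (simp add: U coeff_mult_0)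
  then have U0: "[:coeff U 0:] = 1" by simp
  have split: "pcompose q [:c * of_nat (Suc n), 1:] * (1 - pcompose U [:0, 1 / of_nat (Suc n):]) =
    smult (1 / of_nat (Suc n) ^ k) (pcompose q [:c * of_nat (Suc n), 1:]) *
    (monom 1 k * pcompose V [:0, 1 / of_nat (Suc n):])" for n
  proof -
    have "1 - pcompose U [:0, 1 / of_nat (Suc n):] = pcompose (1 - U) [:0, 1 / of_nat (Suc n):]"
      by (simp only: pcompose_diff pcompose_1)
    also have "\<dots> = pcompose (monom 1 k) [:0, 1 / of_nat (Suc n):] *
        pcompose V [:0, 1 / of_nat (Suc n):]"
      by (simp only: U pcompose_mult)
    also have "pcompose (monom 1 k) [:0, 1 / of_nat (Suc n):] =
        smult (1 / of_nat (Suc n) ^ k) (monom (1::complex) k)"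
      by (rule poly_eqI) (simp add: coeff_pcompose_linear power_one_over del: of_nat_Suc)
    finally show ?thesis by simp
  qed
  have "coeff_tendsto (\<lambda>n. p * pcompose U [:0, 1 / of_nat (Suc n):] +
    pcompose q [:c * of_nat (Suc n), 1:] * (1 - pcompose U [:0, 1 / of_nat (Suc n):]))
    (p * [:coeff U 0:] + 0 * (monom 1 k * [:coeff V 0:]))"
    unfolding split
    by (intro coeff_tendsto_add coeff_tendsto_mult coeff_tendsto_const coeff_tendsto_rescale
        coeff_tendsto_damped_translate k c)
  then show ?thesis by (simp only: U0) simp
qed

text \<open>
  The polynomial \<open>B = (1 - X\<^sup>k)\<^sup>k\<close> is \<open>1\<close> to order \<open>k\<close> at \<open>0\<close> and vanishes to order \<open>k\<close> at \<open>1\<close>,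
  so \<open>p(t) B(t/N) + q(t - N) (1 - B(t/N))\<close> agrees with \<open>p\<close> near \<open>0\<close> and with \<open>q(t - N)\<close> near \<open>N\<close>.
\<close>

lemma translate_interpolation:
  fixes p q :: "complex poly"
  shows "\<exists>r. coeff_tendsto r p \<and> coeff_tendsto (\<lambda>n. pcompose (r n) [:of_nat (Suc n), 1:]) q"
proof -
  \<comment> \<open>\<open>k\<close> exceeds both degrees: damping is needed at \<open>0\<close> for
    the translate of \<open>q\<close> and at \<open>N\<close> for that of \<open>p\<close>.\<close>
  define k where "k = Suc (max (degree p) (degree q))"
  define B :: "complex poly" where "B = (1 - monom 1 k) ^ k"
  have k: "degree p < k" "degree q < k" by (auto simp: k_def)
  obtain V where V: "1 - B = monom 1 k * V"
    using one_diff_power_eq[of "1 - monom (1::complex) k" k] by (auto simp: B_def)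
  \<comment> \<open>\<open>1 - (1 + X) ^ k\<close> is divisible by \<open>X\<close>, hence its
    \<open>k\<close>-th power by \<open>X ^ k\<close>: the zero of \<open>B\<close> at
    \<open>1\<close>, recentred at \<open>0\<close>.\<close>
  obtain W where W: "pcompose B [:1, 1:] = monom 1 k * W"
  proof
    have 1: "pcompose (monom (1::complex) k) [:1, 1:] = [:1, 1:] ^ k"
      by (simp add: pcompose_altdef map_poly_monom poly_monom)
    have "1 - [:1, 1:] ^ k = [:0, - 1 :: complex:] * (\<Sum>i<k. [:1, 1:] ^ i)"
      by (subst one_diff_power_eq) (simp add: one_pCons)
    also have "[:0, - 1 :: complex:] = monom 1 1 * [:- 1:]" by (simp add: monom_altdef)
    finally have 2: "1 - [:1, 1 :: complex:] ^ k = monom 1 1 * ([:- 1:] * (\<Sum>i<k. [:1, 1:] ^ i))"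
      by (simp only: mult.assoc)
    have "pcompose B [:1, 1:] = (1 - [:1, 1:] ^ k) ^ k"
    proof -
      have "pcompose (x ^ j) y = pcompose x y ^ j" for x y :: "complex poly" and j
        by (induction j) (simp_all add: pcompose_mult pcompose_1)
      then show ?thesis by (simp only: B_def pcompose_diff pcompose_1 1)
    qed
    also have "\<dots> = monom 1 k * ([:- 1:] * (\<Sum>i<k. [:1, 1:] ^ i)) ^ k"
      unfolding 2 power_mult_distrib by (simp add: monom_power)
    finally show "pcompose B [:1, 1:] = monom 1 k * ([:- 1:] * (\<Sum>i<k. [:1, 1:] ^ i)) ^ k" .
  qed
  \<comment> \<open>Seen from the point \<open>N\<close>, \<open>U\<close> plays the role of
    \<open>B\<close> with \<open>p\<close> and \<open>q\<close> exchanged.\<close>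
  define U where "U = 1 - pcompose B [:1, 1:]"
  have U: "1 - U = monom 1 k * W" by (simp add: U_def W)
  define r where "r n = p * pcompose B [:0, 1 / of_nat (Suc n):] +
    pcompose q [:- 1 * of_nat (Suc n), 1:] * (1 - pcompose B [:0, 1 / of_nat (Suc n):])" for n
  have "coeff_tendsto r p"
    unfolding r_def[abs_def] by (intro coeff_tendsto_blend[OF V k(2)]) simp
  moreover have "pcompose (r n) [:of_nat (Suc n), 1:] =
    q * pcompose U [:0, 1 / of_nat (Suc n):] +
    pcompose p [:1 * of_nat (Suc n), 1:] * (1 - pcompose U [:0, 1 / of_nat (Suc n):])" for n
  proof -
    have B: "pcompose (pcompose B [:0, 1 / of_nat (Suc n):]) [:of_nat (Suc n), 1:] =
      1 - pcompose U [:0, 1 / of_nat (Suc n):]"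
    proof -
      have "pcompose [:0, 1 / of_nat (Suc n):] [:of_nat (Suc n), 1:] =
          pcompose [:1, 1:] [:0, 1 / of_nat (Suc n) :: complex:]"
        by (simp add: pcompose_pCons field_simps del: of_nat_Suc)
      then show ?thesis
        by (simp only: U_def pcompose_diff pcompose_1 flip: pcompose_assoc) simp
    qed
    have q: "pcompose (pcompose q [:- 1 * of_nat (Suc n), 1:]) [:of_nat (Suc n), 1:] = q"
    proof -
      have "pcompose [:- 1 * of_nat (Suc n), 1:] [:of_nat (Suc n), 1 :: complex:] = [:0, 1:]"
        by (simp add: pcompose_pCons)
      then show ?thesis by (simp only: pcompose_idR flip: pcompose_assoc)
    qed
    show ?thesis
      unfolding r_def pcompose_add pcompose_mult pcompose_diff pcompose_1 B q by simp
  qed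
  then have "coeff_tendsto (\<lambda>n. pcompose (r n) [:of_nat (Suc n), 1:]) q"
    using coeff_tendsto_blend[OF U k(1), of 1 q] by simp
  ultimately show ?thesis by blast
qed

section \<open>The unipotent operator as translation of polynomials\<close>

definition poly_vec :: "(nat \<Rightarrow> 'a::complex_banach) \<Rightarrow> complex poly \<Rightarrow> 'a" where
  "poly_vec v p = (\<Sum>i\<le>degree p. coeff p i *\<^sub>C v i)"

lemma poly_vec_eq: "degree p \<le> D \<Longrightarrow> poly_vec v p = (\<Sum>i\<le>D. coeff p i *\<^sub>C v i)"
  unfolding poly_vec_def by (intro sum.mono_neutral_left) (auto simp: coeff_eq_0)

lemma poly_vec_tendsto:
  assumes "coeff_tendsto r p"
  shows "(\<lambda>n. poly_vec v (r n)) \<longlonglongrightarrow> poly_vec v p"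
proof -
  obtain D where D: "\<And>n. degree (r n) \<le> D" and lim: "\<And>i. (\<lambda>n. coeff (r n) i) \<longlonglongrightarrow> coeff p i"
    using assms by (auto simp: coeff_tendsto_def)
  have "degree p \<le> D"
  proof (rule degree_le, intro allI impI)
    fix i assume "D < i"
    then have "coeff (r n) i = 0" for n using D[of n] by (intro coeff_eq_0) simp
    then have "(\<lambda>n. coeff (r n) i) \<longlonglongrightarrow> 0" by simp
    then show "coeff p i = 0" by (rule LIMSEQ_unique[OF lim])
  qed
  then show ?thesis
    unfolding poly_vec_eq[OF D] poly_vec_eq[OF \<open>degree p \<le> D\<close>]
    by (intro tendsto_sum scaleC.tendsto tendsto_const lim)
qed

lemma poly_vec_translate:
  assumes T: "clinear_operator T" and v: "\<And>i. T (v i) = (\<Sum>l\<le>i. of_nat (i choose l) *\<^sub>C v l)"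
  shows "(T ^^ n) (poly_vec v p) = poly_vec v (pcompose p [:of_nat n, 1:])"
proof -
  interpret bounded_linear T using T by (rule clinear_operator_bounded)
  have step: "T (poly_vec v p) = poly_vec v (pcompose p [:1, 1:])" for p
  proof -
    have "T (poly_vec v p) = (\<Sum>i\<le>degree p. \<Sum>l\<le>degree p. (coeff p i * of_nat (i choose l)) *\<^sub>C v l)"
    proof -
      have "(\<Sum>l\<le>i. (coeff p i * of_nat (i choose l)) *\<^sub>C v l) =
          (\<Sum>l\<le>degree p. (coeff p i * of_nat (i choose l)) *\<^sub>C v l)" if "i \<le> degree p" for i
        using that by (intro sum.mono_neutral_left) auto
      then show ?thesis
        by (simp add: poly_vec_def sum clinear_operator_scale[OF T] v scaleC_scaleC
            scaleC.sum_right)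
    qed
    also have "\<dots> = (\<Sum>l\<le>degree p. coeff (pcompose p [:1, 1:]) l *\<^sub>C v l)"
      by (subst sum.swap) (simp add: coeff_pcompose_translate scaleC.sum_left)
    also have "\<dots> = poly_vec v (pcompose p [:1, 1:])"
      using degree_pcompose_le[of p "[:1, 1:]"] by (intro poly_vec_eq[symmetric]) simp
    finally show ?thesis .
  qed
  show ?thesis
  proof (induction n)
    case (Suc n)
    have "pcompose (pcompose p [:of_nat n, 1:]) [:1, 1:] = pcompose p [:of_nat (Suc n), 1:]"
      by (simp add: pcompose_pCons add.commute flip: pcompose_assoc)
    then show ?case using Suc by (simp add: step)
  qed simp
qed

text \<open>Finite combinations \<open>p\<close> and \<open>q\<close> approximate \<open>x\<close>
  and \<open>y\<close>; an interpolating \<open>r n\<close> is close to \<open>p\<close>, and its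
  translate by \<open>Suc n\<close>, which is its image under \<open>T ^^ Suc n\<close>, is close to
  \<open>q\<close>.\<close>

lemma unipotent_transitive:
  fixes v :: "nat \<Rightarrow> 'a::complex_banach"
  assumes T: "clinear_operator T" and v: "\<And>i. T (v i) = (\<Sum>l\<le>i. of_nat (i choose l) *\<^sub>C v l)"
    and dense: "\<And>y \<epsilon>. 0 < \<epsilon> \<Longrightarrow> \<exists>n a. norm (y - (\<Sum>k<n. a k *\<^sub>C v k)) < \<epsilon>"
    and \<epsilon>: "0 < \<epsilon>"
  shows "\<exists>z n. dist z x < \<epsilon> \<and> dist ((T ^^ n) z) y < \<epsilon>"
proof -
  have approx: "\<exists>p. dist (poly_vec v p) y < \<epsilon> / 2" for y
  proof -
    obtain n a where na: "norm (y - (\<Sum>k<n. a k *\<^sub>C v k)) < \<epsilon> / 2"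
      using dense[of "\<epsilon> / 2" y] \<epsilon> by auto
    define p where "p = (\<Sum>k<n. monom (a k) k)"
    have p: "coeff p i = (if i < n then a i else 0)" for i
      by (simp add: p_def coeff_sum)
    have "degree p \<le> n" by (intro degree_le) (simp add: p)
    then have "poly_vec v p = (\<Sum>k\<le>n. coeff p k *\<^sub>C v k)" by (rule poly_vec_eq)
    also have "\<dots> = (\<Sum>k<n. a k *\<^sub>C v k)"
      by (simp add: p flip: lessThan_Suc_atMost)
    finally show ?thesis using na by (metis dist_commute dist_norm)
  qed
  obtain p q where p: "dist (poly_vec v p) x < \<epsilon> / 2" and q: "dist (poly_vec v q) y < \<epsilon> / 2"
    using approx by meson
  obtain r where r: "coeff_tendsto r p" "coeff_tendsto (\<lambda>n. pcompose (r n) [:of_nat (Suc n), 1:]) q"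
    using translate_interpolation by blast
  have "eventually (\<lambda>n. dist (poly_vec v (r n)) (poly_vec v p) < \<epsilon> / 2 \<and>
      dist (poly_vec v (pcompose (r n) [:of_nat (Suc n), 1:])) (poly_vec v q) < \<epsilon> / 2) sequentially"
    using \<epsilon> by (intro eventually_conj tendstoD[OF poly_vec_tendsto] r) auto
  then obtain n where "dist (poly_vec v (r n)) (poly_vec v p) < \<epsilon> / 2"
      "dist ((T ^^ Suc n) (poly_vec v (r n))) (poly_vec v q) < \<epsilon> / 2"
    unfolding poly_vec_translate[OF T v, symmetric] eventually_sequentially by blast
  then have "dist (poly_vec v (r n)) x < \<epsilon>" "dist ((T ^^ Suc n) (poly_vec v (r n))) y < \<epsilon>"
    using p q by metric+
  then show ?thesis by blast
qed

lemma continuous_multilinear_1: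
  assumes "clinear_operator T"
  shows "continuous_multilinear 1 (\<lambda>u. T (u 0))"
  unfolding continuous_multilinear_def multilinear_def
proof (intro conjI ballI allI impI)
  fix x :: "nat \<Rightarrow> 'a" and i :: nat assume "i < 1"
  interpret bounded_linear T using assms by (rule clinear_operator_bounded)
  show "Vector_Spaces.linear scaleC scaleC (\<lambda>w. T ((x(i := w)) 0))"
    using \<open>i < 1\<close> by unfold_locales (auto simp: add clinear_operator_scale[OF assms])
next
  show "continuous_map (power_topology 1) euclidean (\<lambda>u. T (u 0))"
  proof -
    have "continuous_map (power_topology 1) euclidean (\<lambda>u :: nat \<Rightarrow> 'a. u 0)"
      by (rule continuous_map_product_projection) simp
    moreover have "continuous_map euclidean euclidean T"
      using linear_continuous_on[OF clinear_operator_bounded[OF assms], of UNIV] by simp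
    ultimately have "continuous_map (power_topology 1) euclidean (T \<circ> (\<lambda>u. u 0))"
      by (rule continuous_map_compose)
    then show ?thesis by (simp only: o_def)
  qed
qed

lemma orbit_seq_1: "orbit_seq 1 (\<lambda>u. T (u 0)) x k = (T ^^ k) (x 0)"
proof (induction k)
  case 0
  then show ?case by (subst orbit_seq.simps) simp
next
  case (Suc k)
  then show ?case by (subst orbit_seq.simps) simp
qed

section \<open>The scalar sequence\<close>

text \<open>
  If the functional takes the value \<open>s\<^sub>t\<close> at the \<open>t\<close>-th term of the orbit, then \<open>lam m s t\<close> is the
  product of all scalars that have multiplied the starting vector up to that term.
\<close>

definition lam :: "nat \<Rightarrow> (nat \<Rightarrow> complex) \<Rightarrow> nat \<Rightarrow> complex" where
  "lam m s t = (\<Prod>r\<in>{m..t}. \<Prod>u\<in>{r-m..<r-1}. s u)"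

lemma lam_Suc: "m \<le> Suc t \<Longrightarrow> lam m s (Suc t) = lam m s t * (\<Prod>u\<in>{Suc t - m..<t}. s u)"
  by (simp add: lam_def)

text \<open>The newest argument goes into \<open>N\<close>, so \<open>lam m s t\<close> involves
  only values up to index \<open>t - 2\<close>. Hence \<open>s t\<close> may be defined through
  \<open>lam m s t\<close>.\<close>

lemma lam_cong: "(\<And>u. Suc u < t \<Longrightarrow> s u = s' u) \<Longrightarrow> lam m s t = lam m s' t"
  unfolding lam_def by (intro prod.cong refl) auto

lemma lam_nonzero: "(\<And>u. Suc u < t \<Longrightarrow> s u \<noteq> 0) \<Longrightarrow> lam m s t \<noteq> 0"
  unfolding lam_def by auto

text \<open>The step to \<open>Suc t\<close> brings in \<open>s (t - 1)\<close>, present because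
  \<open>m \<ge> 2\<close>, and otherwise only factors of modulus at least \<open>1\<close>.\<close>

lemma lam_growth:
  assumes m: "2 \<le> m" "m \<le> Suc t" and s: "\<And>u. Suc t - m \<le> u \<Longrightarrow> u < t \<Longrightarrow> 1 \<le> cmod (s u)"
  shows "cmod (lam m s t) * cmod (s (t - 1)) \<le> cmod (lam m s (Suc t))"
proof -
  have "{Suc t - m..<t} = insert (t - 1) {Suc t - m..<t - 1}" using m by auto
  then have "(\<Prod>u\<in>{Suc t - m..<t}. cmod (s u)) =
      cmod (s (t - 1)) * (\<Prod>u\<in>{Suc t - m..<t - 1}. cmod (s u))" by simp
  moreover have "1 \<le> (\<Prod>u\<in>{Suc t - m..<t - 1}. cmod (s u))"
    by (intro prod_ge_1) (use s in auto)
  ultimately have "cmod (s (t - 1)) \<le> (\<Prod>u\<in>{Suc t - m..<t}. cmod (s u))"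
    by (simp add: mult_le_cancel_left1)
  then show ?thesis
    by (simp add: lam_Suc[OF m(2)] norm_mult prod_norm mult_left_mono)
qed

text \<open>One value in the window may be small; inside a block this is the first one.\<close>

lemma lam_growth_except:
  assumes m: "m \<le> Suc t" and c: "0 \<le> c" "c \<le> 1" "c \<le> cmod (s n)"
    and s: "\<And>u. Suc t - m \<le> u \<Longrightarrow> u < t \<Longrightarrow> u \<noteq> n \<Longrightarrow> 1 \<le> cmod (s u)"
  shows "cmod (lam m s t) * c \<le> cmod (lam m s (Suc t))"
proof -
  have "c \<le> (\<Prod>u\<in>{Suc t - m..<t}. if u = n then c else 1)"
    using c by (simp add: prod.delta)
  also have "\<dots> \<le> (\<Prod>u\<in>{Suc t - m..<t}. cmod (s u))"
    using c s by (intro prod_mono) auto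
  finally show ?thesis
    by (simp add: lam_Suc[OF m] norm_mult prod_norm mult_left_mono)
qed

section \<open>Blocks prescribing orbit terms\<close>

text \<open>Solved for \<open>b j\<close>, the equation says that the orbit term at time
  \<open>n\<close> has coefficient \<open>b j\<close> at the \<open>j\<close>-th basis vector. The
  recursion is sound because \<open>lam\<close> at \<open>n + j\<close> does not involve
  \<open>s' (n + j)\<close>.\<close>

lemma block_exists:
  "\<exists>s'. (\<forall>u<n. s' u = s u) \<and> (\<forall>j<k. s' (n + j) = b j * lam m s' (n + j) / lam m s' n)"
proof (induction k)
  case 0
  then show ?case by auto
next
  case (Suc k)
  then obtain s' where s': "\<forall>u<n. s' u = s u"
      "\<forall>j<k. s' (n + j) = b j * lam m s' (n + j) / lam m s' n" by blast
  define s2 where "s2 = s'(n + k := b k * lam m s' (n + k) / lam m s' n)"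
  have "lam m s2 t = lam m s' t" if "t \<le> n + k" for t
    using that by (intro lam_cong) (simp add: s2_def)
  then have "s2 (n + j) = b j * lam m s2 (n + j) / lam m s2 n" if "j < Suc k" for j
    using that s'(2) by (auto simp: less_Suc_eq s2_def)
  moreover have "\<forall>u<n. s2 u = s u" using s'(1) by (simp add: s2_def)
  ultimately show ?case by blast
qed

text \<open>A large value just before the block makes \<open>lam\<close> large behind it.\<close>

lemma block_growth:
  assumes m: "2 \<le> m" "m \<le> n" and k: "0 < k" and c: "0 < c" "c \<le> 1" "\<And>j. j < k \<Longrightarrow> c \<le> cmod (b j)"
    and win: "\<And>u. Suc n - m \<le> u \<Longrightarrow> u < n \<Longrightarrow> 1 \<le> cmod (s u)"
    and nz: "lam m s n \<noteq> 0"
    and blk: "\<And>j. j < k \<Longrightarrow> s (n + j) = b j * lam m s (n + j) / lam m s n"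
    and E: "1 \<le> E" "E \<le> cmod (s (n - 1)) * c ^ Suc k"
  shows "\<And>j. 0 < j \<Longrightarrow> j < k \<Longrightarrow> 1 \<le> cmod (s (n + j))"
    and "cmod (lam m s n) * E \<le> cmod (lam m s (n + k))"
proof -
  define L where "L = cmod (lam m s n)"
  define R where "R = cmod (s (n - 1))"
  have L: "0 < L" using nz by (simp add: L_def)
  have R: "1 \<le> R" using win[of "n - 1"] m by (auto simp: R_def)
  have ck: "E \<le> R * c ^ i" if "i \<le> Suc k" for i
  proof -
    have "c ^ Suc k \<le> c ^ i" using c that by (intro power_decreasing) auto
    then have "R * c ^ Suc k \<le> R * c ^ i" using R by (intro mult_left_mono) auto
    then show ?thesis using E(2) by (simp add: R_def)
  qed
  \<comment> \<open>A block value is \<open>b j\<close> times the growth of \<open>lam\<close> since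
    \<open>n\<close>; a spare factor \<open>c\<close> pays for \<open>b j\<close>.\<close>
  have s_ge: "1 \<le> cmod (s (n + j))" if j: "j < k" and lj: "L * (R * c ^ j) \<le> cmod (lam m s (n + j))" for j
  proof -
    have "1 \<le> c * (R * c ^ j)" using ck[of "Suc j"] j E(1) by (simp add: mult_ac)
    also have "\<dots> \<le> cmod (b j) * (cmod (lam m s (n + j)) / L)"
      using c c(3)[OF j] lj L R by (intro mult_mono) (auto simp: field_simps)
    also have "\<dots> = cmod (s (n + j))" by (simp add: blk[OF j] norm_mult norm_divide L_def)
    finally show ?thesis .
  qed
  \<comment> \<open>The first step gains the large value \<open>R\<close>, and each later one loses
    at most a factor \<open>c\<close>.\<close>
  have main: "L * (R * c ^ j) \<le> cmod (lam m s (n + j))" if "0 < j" "j \<le> k" for j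
    using that
  proof (induction j rule: less_induct)
    case (less j)
    show ?case
    proof (cases "j = 1")
      case True
      have "L * (R * c ^ j) \<le> L * R" using L R c by (simp add: True mult_left_le)
      also have "\<dots> \<le> cmod (lam m s (Suc n))"
        unfolding L_def R_def using m win by (intro lam_growth) auto
      finally show ?thesis by (simp add: True)
    next
      case False
      then obtain i where i: "j = Suc i" "0 < i" using less.prems by (cases j) auto
      have "L * (R * c ^ j) = L * (R * c ^ i) * c" by (simp add: i)
      also have "\<dots> \<le> cmod (lam m s (n + i)) * c"
        using less i c by (intro mult_right_mono less.IH) auto
      also have "\<dots> \<le> cmod (lam m s (Suc (n + i)))"
      proof (rule lam_growth_except[where n = n])
        \<comment> \<open>At \<open>j = 0\<close> the quotient of \<open>lam\<close> values is
          \<open>1\<close>, so this is the one block value that is not enlarged.\<close>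
        have "s n = b 0" using blk[of 0] k nz by simp
        then show "c \<le> cmod (s n)" using c(3)[of 0] k by simp
        fix u assume u: "Suc (n + i) - m \<le> u" "u < n + i" "u \<noteq> n"
        show "1 \<le> cmod (s u)"
        proof (cases "u < n")
          case True
          then show ?thesis using u by (intro win) auto
        next
          case False
          then have "u = n + (u - n)" "0 < u - n" "u - n < i" using u by auto
          then show ?thesis
            using s_ge[of "u - n"] less.IH[of "u - n"] i less.prems by auto
        qed
      qed (use m c in auto)
      finally show ?thesis by (simp add: i)
    qed
  qed
  show "1 \<le> cmod (s (n + j))" if "0 < j" "j < k" for j
    using s_ge[OF _ main] that by simp
  have "L * E \<le> L * (R * c ^ k)" using L ck[of k] by (intro mult_left_mono) auto
  also have "\<dots> \<le> cmod (lam m s (n + k))" using main[of k] k by simp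
  finally show "cmod (lam m s n) * E \<le> cmod (lam m s (n + k))" by (simp add: L_def)
qed

text \<open>
  Between blocks \<open>s\<^sub>t = 2 ^ t ^ 3\<close>; the remaining \<open>2 * t ^ 2 + t\<close> compensates the norms of the basis
  vectors and leaves a summable factor \<open>2\<^bsup>-t\<^esup>\<close>.
\<close>

definition gap_exp :: "nat \<Rightarrow> nat" where
  "gap_exp t = t ^ 3 + 2 * t ^ 2 + t"

lemma gap_exp_mono: "t \<le> t' \<Longrightarrow> gap_exp t \<le> gap_exp t'"
  unfolding gap_exp_def by (intro add_mono mult_le_mono power_mono) auto

text \<open>\<open>gap_exp\<close> grows only quadratically per step, so one cubic filling exponent
  keeps \<open>lam\<close> ahead; \<open>7\<close> is the least possible start.\<close>

lemma gap_exp_Suc: "7 \<le> t \<Longrightarrow> gap_exp (Suc t) \<le> gap_exp t + (t - 1) ^ 3"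
proof -
  assume "7 \<le> t"
  then obtain a where "t = 7 + a" using le_Suc_ex by blast
  then show ?thesis
    by (simp add: gap_exp_def power3_eq_cube power2_eq_square algebra_simps)
qed

text \<open>The large value \<open>2 ^ (2 * n ^ 3)\<close> at \<open>n - 1\<close> must itself be
  small against \<open>lam\<close>. The right side collects \<open>lam\<close> at
  \<open>n - 3\<close> and two filling factors, of order \<open>3 * n ^ 3\<close> in the
  exponent.\<close>

lemma kick_exp:
  assumes "50 \<le> n"
  shows "2 * n ^ 3 + (2 * (n - 1) ^ 2 + (n - 1)) \<le> gap_exp (n - 3) + (n - 4) ^ 3 + (n - 3) ^ 3"
proof -
  obtain a where "n = 50 + a" using assms le_Suc_ex by blast
  then show ?thesis
    by (simp add: gap_exp_def power3_eq_cube power2_eq_square algebra_simps)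
qed

text \<open>\<open>gap_exp\<close> has leading term \<open>n ^ 3\<close>, so the exponent
  \<open>2 * n ^ 3\<close> absorbs any constant and any fixed block length once the block starts
  late.\<close>

lemma eventually_kick_dominates:
  "eventually (\<lambda>n. C * 2 ^ gap_exp (n + k + 1) \<le> (2 ^ (2 * n ^ 3) :: real)) sequentially"
proof -
  obtain p where p: "C \<le> 2 ^ p" using real_arch_pow[of 2 C] by (auto intro: less_imp_le)
  have "eventually (\<lambda>n. real p + ((real n + real k + 1) ^ 3 + 2 * (real n + real k + 1) ^ 2 +
      (real n + real k + 1)) \<le> 2 * real n ^ 3) sequentially"
    by real_asymp
  then show ?thesis
  proof eventually_elim
    case (elim n)
    then have "real (p + gap_exp (n + k + 1)) \<le> real (2 * n ^ 3)"
      by (simp add: gap_exp_def add_ac)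
    then have "p + gap_exp (n + k + 1) \<le> 2 * n ^ 3" by linarith
    then have "(2 :: real) ^ p * 2 ^ gap_exp (n + k + 1) \<le> 2 ^ (2 * n ^ 3)"
      unfolding power_add[symmetric] by (intro power_increasing) auto
    moreover have "C * 2 ^ gap_exp (n + k + 1) \<le> 2 ^ p * 2 ^ gap_exp (n + k + 1)"
      using p by (intro mult_right_mono) auto
    ultimately show ?case by (rule order_trans[rotated])
  qed
qed

text \<open>
  Stage \<open>l\<close> of the construction: block \<open>l\<close> occupies \<open>{n..<n + k}\<close>, and behind it \<open>lam\<close> is so large
  compared with its value at \<open>n\<close> that the values \<open>2 ^ t ^ 3\<close> may follow without disturbing the block.
\<close>

definition stage :: "nat \<Rightarrow> (nat \<Rightarrow> complex) \<Rightarrow> nat \<Rightarrow> nat \<Rightarrow> (nat \<Rightarrow> complex) \<Rightarrow> nat \<Rightarrow> bool" where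
  "stage m b k l s n \<longleftrightarrow>
     (\<forall>t<n + k. s t \<noteq> 0) \<and> (\<forall>t<m - 1. s t = 1) \<and> m + 7 \<le> n \<and>
     (\<forall>j<k. s (n + j) = b j * lam m s (n + j) / lam m s n) \<and>
     (\<forall>t. n + k + 1 - m \<le> t \<longrightarrow> t < n + k \<longrightarrow> 1 \<le> cmod (s t)) \<and>
     cmod (lam m s n) * 2 ^ l * 2 ^ gap_exp (n + k + 1) \<le> cmod (lam m s (n + k))"

section \<open>Adding one stage after another\<close>

lemma nonzero_lower_bound:
  fixes b :: "nat \<Rightarrow> complex"
  assumes "\<And>j. j < k \<Longrightarrow> b j \<noteq> 0"
  shows "\<exists>c>0. c \<le> 1 \<and> (\<forall>j<k. c \<le> cmod (b j))"
  using assms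
proof (induction k)
  case 0
  then show ?case by (intro exI[of _ 1]) auto
next
  case (Suc k)
  then obtain c where "0 < c" "c \<le> 1" "\<forall>j<k. c \<le> cmod (b j)" by auto
  then show ?case using Suc.prems[of k]
    by (intro exI[of _ "min c (cmod (b k))"]) (auto simp: less_Suc_eq min_le_iff_disj)
qed

lemma finite_upper_bound:
  fixes b :: "nat \<Rightarrow> complex"
  shows "\<exists>C\<ge>0. \<forall>j<k. cmod (b j) \<le> C"
  by (intro exI[of _ "\<Sum>j<k. cmod (b j)"]) (auto intro: member_le_sum sum_nonneg)

lemma add_block:
  assumes m: "2 \<le> m" "m \<le> k" and b: "\<And>j. j < k \<Longrightarrow> b j \<noteq> 0"
    and c: "0 < c" "c \<le> 1" "\<And>j. j < k \<Longrightarrow> c \<le> cmod (b j)"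
    and n: "m + 7 \<le> n" and nz: "\<And>t. t < n \<Longrightarrow> s t \<noteq> 0" and init: "\<And>t. t < m - 1 \<Longrightarrow> s t = 1"
    and win: "\<And>u. Suc n - m \<le> u \<Longrightarrow> u < n \<Longrightarrow> 1 \<le> cmod (s u)"
    and kick: "2 ^ l * 2 ^ gap_exp (n + k + 1) \<le> cmod (s (n - 1)) * c ^ Suc k"
  shows "\<exists>s'. (\<forall>u<n. s' u = s u) \<and> stage m b k l s' n"
proof -
  obtain s' where s': "\<And>u. u < n \<Longrightarrow> s' u = s u"
    and blk: "\<And>j. j < k \<Longrightarrow> s' (n + j) = b j * lam m s' (n + j) / lam m s' n"
    using block_exists[of n s k b m] by blast
  have nz': "s' t \<noteq> 0" if "t < n + j" "j \<le> k" for t j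
    using that
  proof (induction j arbitrary: t)
    case 0
    then show ?case using s' nz by simp
  next
    case (Suc j)
    have "lam m s' (n + j) \<noteq> 0" "lam m s' n \<noteq> 0"
      using Suc by (auto intro!: lam_nonzero)
    then have "s' (n + j) \<noteq> 0" using blk[of j] b[of j] Suc.prems by simp
    then show ?case using Suc by (cases "t = n + j") auto
  qed
  have lam0: "lam m s' n \<noteq> 0" using nz'[of _ 0] by (intro lam_nonzero) auto
  have E: "(1::real) \<le> 2 ^ l * 2 ^ gap_exp (n + k + 1)"
    by (simp flip: power_add)
  have win': "1 \<le> cmod (s' u)" if "Suc n - m \<le> u" "u < n" for u
    using win[OF that] s'[OF that(2)] by simp
  have kick': "2 ^ l * 2 ^ gap_exp (n + k + 1) \<le> cmod (s' (n - 1)) * c ^ Suc k"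
    using kick s'[of "n - 1"] n by simp
  have mn: "m \<le> n" "0 < k" using m n by auto
  note growth = block_growth[OF m(1) mn c win' lam0 blk E kick']
  \<comment> \<open>Since \<open>m \<le> k\<close>, this window starts after \<open>n\<close> and
    avoids \<open>s' n = b 0\<close>, which may be small.\<close>
  have "1 \<le> cmod (s' t)" if "n + k + 1 - m \<le> t" "t < n + k" for t
    using growth(1)[of "t - n"] that m by simp
  moreover have "cmod (lam m s' n) * 2 ^ l * 2 ^ gap_exp (n + k + 1) \<le> cmod (lam m s' (n + k))"
    using growth(2) by (simp add: mult.assoc)
  moreover have "s' t = 1" if "t < m - 1" for t
    using s'[of t] init[OF that] that n by simp
  ultimately have "stage m b k l s' n"
    unfolding stage_def using nz'[of _ k] blk n by auto
  then show ?thesis using s' by blast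
qed

lemma first_stage:
  assumes m: "2 \<le> m" "m \<le> k" and b: "\<And>j. j < k \<Longrightarrow> b j \<noteq> 0"
  shows "\<exists>s n. stage m b k l s n"
proof -
  obtain c where c: "0 < c" "c \<le> 1" "\<And>j. j < k \<Longrightarrow> c \<le> cmod (b j)"
    using nonzero_lower_bound[of k b] b by blast
  define n where "n = m + 7"
  define E :: real where "E = 2 ^ l * 2 ^ gap_exp (n + k + 1)"
  \<comment> \<open>All values are \<open>1\<close> except the one before the block, chosen to meet
    the growth condition of \<open>add_block\<close> with equality.\<close>
  define s where "s t = (if t = n - 1 then complex_of_real (E / c ^ Suc k) else 1)" for t
  have "1 \<le> E" unfolding E_def by (simp flip: power_add)
  moreover have "c ^ Suc k \<le> 1" using c by (intro power_le_one) auto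
  ultimately have ge: "1 \<le> E / c ^ Suc k" using c by (subst le_divide_eq) auto
  have s: "1 \<le> cmod (s t)" for t
  proof (cases "t = n - 1")
    case True
    then have "s t = complex_of_real (E / c ^ Suc k)" by (simp add: s_def)
    then show ?thesis using ge by (simp only: norm_of_real)
  qed (simp add: s_def)
  have "\<exists>s'. (\<forall>u<n. s' u = s u) \<and> stage m b k l s' n"
  proof (rule add_block[OF m b c])
    show "s t \<noteq> 0" for t using s[of t] by auto
    show "s t = 1" if "t < m - 1" for t using that by (auto simp: s_def n_def)
    show "2 ^ l * 2 ^ gap_exp (n + k + 1) \<le> cmod (s (n - 1)) * c ^ Suc k"
      using ge c by (simp add: s_def norm_divide norm_mult norm_power E_def)
  qed (use s in \<open>auto simp: n_def\<close>)
  then show ?thesis by blast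
qed

text \<open>The old block is followed by filling values, a large value at \<open>n' - 1\<close> and
  the new block. The last estimate keeps all of them from disturbing the orbit term at
  \<open>n\<close>.\<close>

lemma next_stage:
  assumes m: "2 \<le> m" "m \<le> k'" and b: "\<And>j. j < k' \<Longrightarrow> b' j \<noteq> 0"
    and st: "stage m b k l s n" and k: "m \<le> k"
  shows "\<exists>s' n'. stage m b' k' l' s' n' \<and> n + k \<le> n' \<and> (\<forall>u<n + k. s' u = s u) \<and>
    cmod (lam m s n) \<le> cmod (lam m s' n') \<and>
    (\<forall>t. n + k \<le> t \<longrightarrow> t < n' + k' \<longrightarrow>
      cmod (s' t) * (cmod (lam m s n) * 2 ^ l) * 2 ^ (2 * t ^ 2 + t) \<le> cmod (lam m s' t))"
proof -
  define N where "N = n + k"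
  define A where "A = cmod (lam m s n) * 2 ^ l"
  have nz: "\<And>t. t < N \<Longrightarrow> s t \<noteq> 0" and init: "\<And>t. t < m - 1 \<Longrightarrow> s t = 1" and mn: "m + 7 \<le> n"
    and win: "\<And>t. N + 1 - m \<le> t \<Longrightarrow> t < N \<Longrightarrow> 1 \<le> cmod (s t)"
    and base: "A * 2 ^ gap_exp (N + 1) \<le> cmod (lam m s N)"
    using st by (auto simp: stage_def N_def A_def)
  have nN: "n \<le> N" "m + 7 \<le> N" using mn by (auto simp: N_def)
  have "lam m s n \<noteq> 0" using nz nN by (intro lam_nonzero) auto
  then have A: "0 < A" by (simp add: A_def)
  obtain c where c: "0 < c" "c \<le> 1" "\<And>j. j < k' \<Longrightarrow> c \<le> cmod (b' j)"
    using nonzero_lower_bound[of k' b'] b by blast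
  obtain C where C: "0 \<le> C" "\<And>j. j < k' \<Longrightarrow> cmod (b' j) \<le> C"
    using finite_upper_bound[of k' b'] by blast
  \<comment> \<open>The two inequalities let the large value outgrow the coefficients of the new
    block and meet the growth condition of \<open>add_block\<close>.\<close>
  have "eventually (\<lambda>n'. N + 50 \<le> n' \<and> C * 2 ^ gap_exp (n' + k' + 1) \<le> (2 ^ (2 * n' ^ 3) :: real) \<and>
      2 ^ l' / c ^ Suc k' * 2 ^ gap_exp (n' + k' + 1) \<le> (2 ^ (2 * n' ^ 3) :: real)) sequentially"
    by (intro eventually_conj eventually_kick_dominates eventually_ge_at_top)
  then obtain n' where n': "N + 50 \<le> n'"
    and CC: "C * 2 ^ gap_exp (n' + k' + 1) \<le> 2 ^ (2 * n' ^ 3)"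
    and cc: "2 ^ l' / c ^ Suc k' * 2 ^ gap_exp (n' + k' + 1) \<le> 2 ^ (2 * n' ^ 3)"
    unfolding eventually_sequentially by blast
  \<comment> \<open>the larger value at \<open>n' - 1\<close> is the one that \<open>block_growth\<close> needs just before the block\<close>
  define s1 where "s1 t = (if t < N then s t else if t = n' - 1 then 2 ^ (2 * n' ^ 3) else 2 ^ (t ^ 3))"
    for t
  have s1_old: "s1 t = s t" if "t < N" for t using that by (simp add: s1_def)
  have s1_fill: "cmod (s1 t) = 2 ^ (t ^ 3)" if "N \<le> t" "t < n' - 1" for t
    using that by (simp add: s1_def norm_power)
  have s1_kick: "cmod (s1 (n' - 1)) = 2 ^ (2 * n' ^ 3)"
    using n' by (simp add: s1_def norm_power)
  have s1_ge: "1 \<le> cmod (s1 t)" if "N + 1 - m \<le> t" for t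
    using that win[of t] by (cases "t < N") (auto simp: s1_def norm_power)
  have s1_nz: "s1 t \<noteq> 0" for t
    using nz by (auto simp: s1_def)
  have lamN: "lam m s1 t = lam m s t" if "t \<le> N" for t
    using that by (intro lam_cong s1_old) simp
  have grow: "cmod (lam m s1 t) * cmod (s1 (t - 1)) \<le> cmod (lam m s1 (Suc t))" if "N \<le> t" for t
    using that nN by (intro lam_growth m s1_ge) auto
  have grow': "cmod (lam m s1 t) \<le> cmod (lam m s1 (Suc t))" if "N \<le> t" for t
  proof -
    have "cmod (lam m s1 t) * 1 \<le> cmod (lam m s1 t) * cmod (s1 (t - 1))"
      using that m nN by (intro mult_left_mono s1_ge) auto
    then show ?thesis using grow[OF that] by simp
  qed
  have fill: "A * 2 ^ gap_exp t \<le> cmod (lam m s1 t)" if "N \<le> t" "t \<le> n' - 1" for t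
    using that
  proof (induction t rule: dec_induct)
    case base
    have "A * 2 ^ gap_exp N \<le> A * 2 ^ gap_exp (N + 1)"
      using A by (intro mult_left_mono power_increasing gap_exp_mono) auto
    then show ?case using \<open>A * 2 ^ gap_exp (N + 1) \<le> cmod (lam m s N)\<close> by (simp add: lamN)
  next
    case (step t)
    show ?case
    proof (cases "t = N")
      case True
      \<comment> \<open>Here \<open>s1 (t - 1)\<close> still belongs to the old block and gives no
        cubic gain; this is why \<open>stage\<close> carries \<open>gap_exp\<close> one index
        ahead.\<close>
      then show ?thesis using base grow'[of N] by (simp add: lamN)
    next
      case False
      then have t: "N + 1 \<le> t" using step by simp
      have "gap_exp (Suc t) \<le> gap_exp t + (t - 1) ^ 3" using t nN by (intro gap_exp_Suc) auto
      then have "A * 2 ^ gap_exp (Suc t) \<le> A * 2 ^ (gap_exp t + (t - 1) ^ 3)"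
        using A by (intro mult_left_mono power_increasing) auto
      also have "\<dots> = A * 2 ^ gap_exp t * 2 ^ ((t - 1) ^ 3)" by (simp add: power_add)
      also have "\<dots> \<le> cmod (lam m s1 t) * cmod (s1 (t - 1))"
        using step t by (subst s1_fill) (auto intro!: mult_right_mono)
      also have "\<dots> \<le> cmod (lam m s1 (Suc t))" using step by (intro grow)
      finally show ?thesis .
    qed
  qed
  have kick_room: "2 ^ (2 * n' ^ 3) * (A * 2 ^ (2 * (n' - 1) ^ 2 + (n' - 1))) \<le> cmod (lam m s1 (n' - 1))"
  proof -
    have 1: "Suc (n' - 3) = n' - 2" "Suc (n' - 2) = n' - 1" "n' - 3 - 1 = n' - 4" "n' - 2 - 1 = n' - 3"
      using n' by auto
    have "2 ^ (2 * n' ^ 3) * (A * 2 ^ (2 * (n' - 1) ^ 2 + (n' - 1))) =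
        A * 2 ^ (2 * n' ^ 3 + (2 * (n' - 1) ^ 2 + (n' - 1)))"
      by (simp add: power_add)
    also have "\<dots> \<le> A * 2 ^ (gap_exp (n' - 3) + (n' - 4) ^ 3 + (n' - 3) ^ 3)"
      using A n' by (intro mult_left_mono power_increasing kick_exp) auto
    also have "\<dots> = A * 2 ^ gap_exp (n' - 3) * 2 ^ ((n' - 4) ^ 3) * 2 ^ ((n' - 3) ^ 3)"
      by (simp add: power_add)
    also have "\<dots> \<le> cmod (lam m s1 (n' - 3)) * 2 ^ ((n' - 4) ^ 3) * 2 ^ ((n' - 3) ^ 3)"
      using n' by (intro mult_right_mono fill) auto
    also have "\<dots> \<le> cmod (lam m s1 (n' - 2)) * 2 ^ ((n' - 3) ^ 3)"
      using grow[of "n' - 3"] n' by (intro mult_right_mono) (auto simp: 1 s1_fill)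
    also have "\<dots> \<le> cmod (lam m s1 (n' - 1))"
      using grow[of "n' - 2"] n' by (auto simp: 1 s1_fill)
    finally show ?thesis .
  qed
  \<comment> \<open>In the new block \<open>s' t / lam m s' t\<close> equals
    \<open>b' j / lam m s' n'\<close>, so a lower bound at \<open>n'\<close> controls it.\<close>
  have big: "2 ^ (2 * n' ^ 3) * A \<le> cmod (lam m s1 n')"
  proof -
    have "2 ^ (2 * n' ^ 3) * (A * 1) \<le> 2 ^ (2 * n' ^ 3) * (A * 2 ^ (2 * (n' - 1) ^ 2 + (n' - 1)))"
      using A by (intro mult_left_mono) auto
    also have "\<dots> \<le> cmod (lam m s1 (n' - 1))" by (rule kick_room)
    also have "\<dots> \<le> cmod (lam m s1 n')" using grow'[of "n' - 1"] n' by simp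
    finally show ?thesis by simp
  qed
  have "\<exists>s'. (\<forall>u<n'. s' u = s1 u) \<and> stage m b' k' l' s' n'"
  proof (rule add_block[OF m b c])
    show "m + 7 \<le> n'" using nN n' by simp
    show "s1 t = 1" if "t < m - 1" for t using that nN init[OF that] by (simp add: s1_def)
    show "1 \<le> cmod (s1 u)" if "Suc n' - m \<le> u" for u
      using that n' by (intro s1_ge) auto
    show "2 ^ l' * 2 ^ gap_exp (n' + k' + 1) \<le> cmod (s1 (n' - 1)) * c ^ Suc k'"
      using cc c unfolding s1_kick by (simp add: field_simps)
  qed (simp_all add: s1_nz)
  then obtain s' where s': "\<And>u. u < n' \<Longrightarrow> s' u = s1 u" and st': "stage m b' k' l' s' n'" by blast
  have lam': "lam m s' t = lam m s1 t" if "t \<le> n'" for t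
    using that by (intro lam_cong s') simp
  have mono: "cmod (lam m s n) \<le> cmod (lam m s' n')"
  proof -
    have "cmod (lam m s n) \<le> A" by (simp add: A_def mult_le_cancel_left1)
    also have "\<dots> \<le> 2 ^ (2 * n' ^ 3) * A" using A by (simp add: mult_le_cancel_right1)
    finally show ?thesis using big by (simp add: lam')
  qed
  have small: "cmod (s' t) * A * 2 ^ (2 * t ^ 2 + t) \<le> cmod (lam m s' t)" if t: "N \<le> t" "t < n' + k'" for t
  proof -
    \<comment> \<open>Filling values, the large value and the new block.\<close>
    consider "t < n' - 1" | "t = n' - 1" | "n' \<le> t" by linarith
    then show ?thesis
    proof cases
      case 1
      then have "cmod (s' t) * A * 2 ^ (2 * t ^ 2 + t) = A * 2 ^ gap_exp t"
        using t by (simp add: s' s1_fill gap_exp_def power_add)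
      also have "\<dots> \<le> cmod (lam m s1 t)" using t 1 by (intro fill) auto
      finally show ?thesis using 1 by (simp only: lam')
    next
      case 2
      have "s' (n' - 1) = s1 (n' - 1)" "lam m s' (n' - 1) = lam m s1 (n' - 1)"
        using n' by (auto intro!: s' lam')
      then show ?thesis using kick_room by (simp only: 2 s1_kick mult.assoc)
    next
      case 3
      define j where "j = t - n'"
      have j: "t = n' + j" "j < k'" using 3 t by (auto simp: j_def)
      have "s' t = b' j * lam m s' t / lam m s' n'"
        using st' j by (simp add: stage_def)
      then have eq: "cmod (s' t) = cmod (b' j) * cmod (lam m s' t) / cmod (lam m s1 n')"
        by (simp add: norm_mult norm_divide lam')
      have "2 * t ^ 2 + t \<le> gap_exp t" by (simp add: gap_exp_def)
      also have "\<dots> \<le> gap_exp (n' + k' + 1)" using t by (intro gap_exp_mono) simp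
      finally have "cmod (b' j) * 2 ^ (2 * t ^ 2 + t) \<le> C * 2 ^ gap_exp (n' + k' + 1)"
        using C j by (intro mult_mono power_increasing) auto
      then have "cmod (b' j) * 2 ^ (2 * t ^ 2 + t) * A \<le> 2 ^ (2 * n' ^ 3) * A"
        using CC A by (intro mult_right_mono) auto
      then have le: "cmod (b' j) * 2 ^ (2 * t ^ 2 + t) * A \<le> cmod (lam m s1 n')" using big by simp
      have pos: "0 < cmod (lam m s1 n')" using lam_nonzero s1_nz by simp
      have "cmod (s' t) * A * 2 ^ (2 * t ^ 2 + t) =
          (cmod (b' j) * 2 ^ (2 * t ^ 2 + t) * A) * cmod (lam m s' t) / cmod (lam m s1 n')"
        by (simp add: eq)
      also have "\<dots> \<le> cmod (lam m s1 n') * cmod (lam m s' t) / cmod (lam m s1 n')"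
        using le by (intro divide_right_mono mult_right_mono) auto
      finally show ?thesis using pos by simp
    qed
  qed
  have "s' u = s u" if "u < n + k" for u
    using that s'[of u] s1_old[of u] n' by (simp add: N_def)
  then show ?thesis
    using st' mono small n' unfolding A_def N_def by (intro exI[of _ s'] exI[of _ n']) auto
qed

text \<open>Dependent choice yields stages extending one another, and the limit sequence inherits
  their estimates.\<close>

lemma block_sequence:
  assumes m: "2 \<le> m" and k: "\<And>l. m \<le> k l" and b: "\<And>l j. j < k l \<Longrightarrow> b l j \<noteq> 0"
  obtains s n where "\<And>t. s t \<noteq> 0" "\<And>t. t < m - 1 \<Longrightarrow> s t = 1" "\<And>l. m \<le> n l"
    "\<And>l j. j < k l \<Longrightarrow> s (n l + j) = b l j * lam m s (n l + j) / lam m s (n l)"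
    "\<And>l t. n l + k l \<le> t \<Longrightarrow>
      cmod (s t) * (cmod (lam m s (n l)) * 2 ^ l) * 2 ^ (2 * t ^ 2 + t) \<le> cmod (lam m s t)"
proof -
  have "\<exists>\<phi>. \<forall>l. stage m (b l) (k l) l (fst (\<phi> l)) (snd (\<phi> l)) \<and>
    (snd (\<phi> l) + k l \<le> snd (\<phi> (Suc l)) \<and>
     (\<forall>u<snd (\<phi> l) + k l. fst (\<phi> (Suc l)) u = fst (\<phi> l) u) \<and>
     cmod (lam m (fst (\<phi> l)) (snd (\<phi> l))) \<le> cmod (lam m (fst (\<phi> (Suc l))) (snd (\<phi> (Suc l)))) \<and>
     (\<forall>t. snd (\<phi> l) + k l \<le> t \<longrightarrow> t < snd (\<phi> (Suc l)) + k (Suc l) \<longrightarrow>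
       cmod (fst (\<phi> (Suc l)) t) * (cmod (lam m (fst (\<phi> l)) (snd (\<phi> l))) * 2 ^ l) * 2 ^ (2 * t ^ 2 + t)
         \<le> cmod (lam m (fst (\<phi> (Suc l))) t)))"
  proof (rule dependent_nat_choice)
    show "\<exists>x. stage m (b 0) (k 0) 0 (fst x) (snd x)"
      using first_stage[of m "k 0" "b 0" 0] m k b by auto
  next
    fix x :: "(nat \<Rightarrow> complex) \<times> nat" and l
    assume "stage m (b l) (k l) l (fst x) (snd x)"
    from next_stage[where k' = "k (Suc l)" and b' = "b (Suc l)" and l' = "Suc l", OF m k b this k]
    show "\<exists>y. stage m (b (Suc l)) (k (Suc l)) (Suc l) (fst y) (snd y) \<and>
      (snd x + k l \<le> snd y \<and> (\<forall>u<snd x + k l. fst y u = fst x u) \<and>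
       cmod (lam m (fst x) (snd x)) \<le> cmod (lam m (fst y) (snd y)) \<and>
       (\<forall>t. snd x + k l \<le> t \<longrightarrow> t < snd y + k (Suc l) \<longrightarrow>
         cmod (fst y t) * (cmod (lam m (fst x) (snd x)) * 2 ^ l) * 2 ^ (2 * t ^ 2 + t)
           \<le> cmod (lam m (fst y) t)))"
      by simp
  qed
  then obtain \<phi> where \<phi>: "\<And>l. stage m (b l) (k l) l (fst (\<phi> l)) (snd (\<phi> l)) \<and>
    (snd (\<phi> l) + k l \<le> snd (\<phi> (Suc l)) \<and>
     (\<forall>u<snd (\<phi> l) + k l. fst (\<phi> (Suc l)) u = fst (\<phi> l) u) \<and>
     cmod (lam m (fst (\<phi> l)) (snd (\<phi> l))) \<le> cmod (lam m (fst (\<phi> (Suc l))) (snd (\<phi> (Suc l)))) \<and>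
     (\<forall>t. snd (\<phi> l) + k l \<le> t \<longrightarrow> t < snd (\<phi> (Suc l)) + k (Suc l) \<longrightarrow>
       cmod (fst (\<phi> (Suc l)) t) * (cmod (lam m (fst (\<phi> l)) (snd (\<phi> l))) * 2 ^ l) * 2 ^ (2 * t ^ 2 + t)
         \<le> cmod (lam m (fst (\<phi> (Suc l))) t)))"
    by blast
  define \<sigma> where "\<sigma> l = fst (\<phi> l)" for l
  define n where "n l = snd (\<phi> l)" for l
  have st: "stage m (b l) (k l) l (\<sigma> l) (n l)"
    and le: "n l + k l \<le> n (Suc l)"
    and grow: "cmod (lam m (\<sigma> l) (n l)) \<le> cmod (lam m (\<sigma> (Suc l)) (n (Suc l)))" for l
    using \<phi>[of l] by (simp_all add: \<sigma>_def n_def)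
  have agree: "\<sigma> (Suc l) u = \<sigma> l u" if "u < n l + k l" for l u
    using \<phi>[of l] that by (simp add: \<sigma>_def n_def)
  have small: "cmod (\<sigma> (Suc l) t) * (cmod (lam m (\<sigma> l) (n l)) * 2 ^ l) * 2 ^ (2 * t ^ 2 + t)
      \<le> cmod (lam m (\<sigma> (Suc l)) t)" if "n l + k l \<le> t" "t < n (Suc l) + k (Suc l)" for l t
    using \<phi>[of l] that by (simp add: \<sigma>_def n_def)
  have k0: "0 < k l" for l using m k[of l] by simp
  have sm: "strict_mono n"
    using le k0 by (intro strict_monoI_Suc) (metis less_add_same_cancel1 less_le_trans)
  have agree': "\<sigma> l' u = \<sigma> l u" if "l \<le> l'" "u < n l + k l" for l l' u
    using that(1)
  proof (induction l' rule: dec_induct)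
    case (step i)
    have "n l \<le> n i" using sm step(1) by (simp add: strict_mono_less_eq)
    moreover have "n l + k l \<le> n i" if "l < i"
      using le[of l] strict_mono_less_eq[OF sm, of "Suc l" i] that by simp
    ultimately have "u < n i + k i" using that(2) step(1) by (cases "l = i") auto
    then show ?case using agree step by simp
  qed simp
  have n_ge: "t \<le> n t" for t using strict_mono_imp_increasing[OF sm] .
  \<comment> \<open>The diagonal value is final: \<open>t \<le> n t < n t + k t\<close> lies within
    stage \<open>t\<close>.\<close>
  define s where "s t = \<sigma> t t" for t
  have s: "s u = \<sigma> l u" if "u < n l + k l" for u l
  proof (cases "l \<le> u")
    case True
    then show ?thesis using agree'[of l u u] that by (simp add: s_def)
  next
    case False
    have "u < n u + k u" using n_ge[of u] k0[of u] by simp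
    then show ?thesis using agree'[of u l u] False by (simp add: s_def)
  qed
  have lam: "lam m s t = lam m (\<sigma> l) t" if "t \<le> n l + k l" for t l
    using that by (intro lam_cong s) simp
  have grow': "cmod (lam m s (n l)) \<le> cmod (lam m s (n l'))" if "l \<le> l'" for l l'
    using that
  proof (induction l' rule: dec_induct)
    case (step i)
    then show ?case using grow[of i] by (simp add: lam[of _ i] lam[of _ "Suc i"])
  qed simp
  show ?thesis
  proof (rule that)
    show "s t \<noteq> 0" for t
      using st[of t] n_ge[of t] k0[of t] by (simp add: stage_def s_def)
    show "s t = 1" if "t < m - 1" for t
      using st[of t] that by (simp add: stage_def s_def)
    show "m \<le> n l" for l using st[of l] by (simp add: stage_def)
    show "s (n l + j) = b l j * lam m s (n l + j) / lam m s (n l)" if "j < k l" for l j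
      using st[of l] that by (simp add: stage_def lam[of _ l] s[of _ l])
    show "cmod (s t) * (cmod (lam m s (n l)) * 2 ^ l) * 2 ^ (2 * t ^ 2 + t) \<le> cmod (lam m s t)"
      if t: "n l + k l \<le> t" for l t
    proof -
      \<comment> \<open>The estimate for \<open>l\<close> follows from that of the stage reaching
        \<open>t\<close>, since \<open>lam\<close> at the block starts and \<open>2 ^ l\<close> both
        grow with \<open>l\<close>.\<close>
      have "\<exists>i\<ge>l. n i + k i \<le> t \<and> t < n (Suc i) + k (Suc i)"
      proof (rule ccontr)
        assume *: "\<not> (\<exists>i\<ge>l. n i + k i \<le> t \<and> t < n (Suc i) + k (Suc i))"
        have "n i + k i \<le> t" if "l \<le> i" for i
          using that
        proof (induction i rule: dec_induct)
          case (step i)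
          then show ?case using * by (metis not_le)
        qed (rule t)
        from this[of "Suc (t + l)"] show False using n_ge[of "Suc (t + l)"] by simp
      qed
      then obtain i where i: "l \<le> i" "n i + k i \<le> t" "t < n (Suc i) + k (Suc i)" by blast
      have "cmod (lam m s (n l)) * 2 ^ l \<le> cmod (lam m s (n i)) * 2 ^ i"
        using grow' i(1) by (intro mult_mono power_increasing) auto
      then have "cmod (s t) * (cmod (lam m s (n l)) * 2 ^ l) * 2 ^ (2 * t ^ 2 + t) \<le>
          cmod (s t) * (cmod (lam m s (n i)) * 2 ^ i) * 2 ^ (2 * t ^ 2 + t)"
        by (intro mult_right_mono mult_left_mono) auto
      also have "\<dots> \<le> cmod (lam m s t)"
        using small[OF i(2,3)] i by (simp add: lam[of _ i] lam[of _ "Suc i"] s[of _ "Suc i"])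
      finally show ?thesis .
    qed
  qed
qed

section \<open>Multilinear operators\<close>

text \<open>Block values must not vanish, so zero coefficients become a small
  \<open>\<delta>\<close>. Padding to \<open>k \<ge> m\<close> makes each block at least as long as
  the window of the \<open>m\<close>-linear map.\<close>

lemma dense_nonzero_coeffs:
  fixes v :: "nat \<Rightarrow> 'a::complex_banach"
  assumes dense: "\<And>y \<epsilon>. 0 < \<epsilon> \<Longrightarrow> \<exists>n a. norm (y - (\<Sum>k<n. a k *\<^sub>C v k)) < \<epsilon>"
    and \<epsilon>: "0 < \<epsilon>"
  shows "\<exists>k b. m \<le> k \<and> (\<forall>j. b j \<noteq> 0) \<and> norm (y - (\<Sum>j<k. b j *\<^sub>C v j)) < \<epsilon>"
proof -
  obtain n a where a: "norm (y - (\<Sum>k<n. a k *\<^sub>C v k)) < \<epsilon> / 2"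
    using dense[of "\<epsilon> / 2" y] \<epsilon> by auto
  define k where "k = max n m"
  define S where "S = (\<Sum>j<k. norm (v j))"
  have S: "0 \<le> S" unfolding S_def by (intro sum_nonneg) auto
  define \<delta> where "\<delta> = \<epsilon> / 2 / (1 + S)"
  have \<delta>: "0 < \<delta>" "\<delta> * S \<le> \<epsilon> / 2"
    using \<epsilon> S by (auto simp: \<delta>_def field_simps)
  define a' where "a' j = (if j < n then a j else 0)" for j
  define b where "b j = (if a' j = 0 then complex_of_real \<delta> else a' j)" for j
  have "(\<Sum>j<k. a' j *\<^sub>C v j) = (\<Sum>j<n. a j *\<^sub>C v j)"
    unfolding a'_def by (rule sum.mono_neutral_cong_right) (auto simp: k_def)
  moreover have "norm ((\<Sum>j<k. a' j *\<^sub>C v j) - (\<Sum>j<k. b j *\<^sub>C v j)) \<le> \<epsilon> / 2"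
  proof -
    have "norm (\<Sum>j<k. (a' j - b j) *\<^sub>C v j) \<le> (\<Sum>j<k. \<delta> * norm (v j))"
      using \<delta> by (intro sum_norm_le) (auto simp: norm_scaleC b_def)
    also have "\<dots> \<le> \<epsilon> / 2" using \<delta> by (simp add: S_def flip: sum_distrib_left)
    finally show ?thesis by (simp add: scaleC.diff_left sum_subtractf)
  qed
  ultimately have "norm (y - (\<Sum>j<k. b j *\<^sub>C v j)) < \<epsilon>"
    using a norm_triangle_ineq[of "y - (\<Sum>k<n. a k *\<^sub>C v k)"
        "(\<Sum>j<k. a' j *\<^sub>C v j) - (\<Sum>j<k. b j *\<^sub>C v j)"] by simp
  moreover have "b j \<noteq> 0" for j using \<delta> by (simp add: b_def)
  ultimately show ?thesis by (intro exI[of _ k] exI[of _ b]) (auto simp: k_def)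
qed

definition shift_form :: "nat \<Rightarrow> ('a::complex_banach \<Rightarrow> complex) \<Rightarrow> ('a \<Rightarrow> 'a) \<Rightarrow> (nat \<Rightarrow> 'a) \<Rightarrow> 'a" where
  "shift_form m f N u = (\<Prod>i<m-1. f (u i)) *\<^sub>C N (u (m - 1))"

lemma continuous_multilinear_shift_form:
  fixes f :: "'a::complex_banach \<Rightarrow> complex"
  assumes m: "1 \<le> m" and f: "clinear_functional f" and N: "clinear_operator N"
  shows "continuous_multilinear m (shift_form m f N)"
  unfolding continuous_multilinear_def multilinear_def
proof (intro conjI ballI allI impI)
  interpret f: bounded_linear f using f by (rule clinear_functional_bounded)
  interpret N: bounded_linear N using N by (rule clinear_operator_bounded)
  fix x :: "nat \<Rightarrow> 'a" and i assume i: "i < m"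
  show "Vector_Spaces.linear scaleC scaleC (\<lambda>w. shift_form m f N (x(i := w)))"
  proof (cases "i = m - 1")
    case True
    then have "shift_form m f N (x(i := w)) = (\<Prod>i<m-1. f (x i)) *\<^sub>C N w" for w
      unfolding shift_form_def by (intro arg_cong2[where f = scaleC] prod.cong) auto
    then show ?thesis
      by unfold_locales
        (simp_all add: N.add clinear_operator_scale[OF N] scaleC_add_right scaleC_scaleC mult.commute)
  next
    case False
    then have i': "i \<in> {..<m-1}" using i by auto
    have "shift_form m f N (x(i := w)) =
        (f w * (\<Prod>j\<in>{..<m-1} - {i}. f (x j))) *\<^sub>C N (x (m - 1))" for w
      unfolding shift_form_def using False i'
      by (subst prod.remove[OF _ i']) (auto intro!: arg_cong2[where f = scaleC] prod.cong)
    then show ?thesis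
      by unfold_locales
        (simp_all add: f.add clinear_functional_scale[OF f] scaleC_add_left scaleC_scaleC
          algebra_simps)
  qed
next
  interpret f: bounded_linear f using f by (rule clinear_functional_bounded)
  interpret N: bounded_linear N using N by (rule clinear_operator_bounded)
  show "continuous_map (power_topology m) euclidean (shift_form m f N)"
    unfolding continuous_map_atin limitin_canonical_iff
  proof
    fix x :: "nat \<Rightarrow> 'a" assume x: "x \<in> topspace (power_topology m)"
    have coord: "((\<lambda>u. u i) \<longlongrightarrow> x i) (atin (power_topology m) x)" if "i < m" for i
      using continuous_map_product_projection[of i "{..<m}" "\<lambda>_. euclidean :: 'a topology"] x that
      unfolding continuous_map_atin limitin_canonical_iff by auto
    show "(shift_form m f N \<longlongrightarrow> shift_form m f N x) (atin (power_topology m) x)"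
      unfolding shift_form_def[abs_def]
      using m by (intro scaleC.tendsto tendsto_prod f.tendsto N.tendsto coord) auto
  qed
qed

text \<open>Since \<open>j \<le> t + j\<close>, the weight at \<open>t + j\<close> dominates
  \<open>norm (v j)\<close> and leaves \<open>2 ^ j\<close> for convergence.\<close>

lemma shift_series_summable:
  fixes v :: "nat \<Rightarrow> 'a::complex_banach"
  assumes v: "\<And>i. norm (v i) \<le> 2 ^ (2 * i\<^sup>2)"
    and \<xi>: "\<And>u. q \<le> u \<Longrightarrow> cmod (\<xi> u) * 2 ^ (2 * u\<^sup>2 + u) \<le> C"
  shows "\<And>j. q \<le> t + j \<Longrightarrow> norm (\<xi> (t + j) *\<^sub>C v j) \<le> C * (1 / 2) ^ j"
    and "summable (\<lambda>j. norm (\<xi> (t + j) *\<^sub>C v j))"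
proof -
  show le: "norm (\<xi> (t + j) *\<^sub>C v j) \<le> C * (1 / 2) ^ j" if "q \<le> t + j" for j
  proof -
    have "2 * j\<^sup>2 + j \<le> 2 * (t + j)\<^sup>2 + (t + j)"
      by (intro add_mono mult_le_mono power_mono) auto
    then have "(2::real) ^ (2 * j\<^sup>2) * 2 ^ j \<le> 2 ^ (2 * (t + j)\<^sup>2 + (t + j))"
      unfolding power_add[symmetric] by (rule power_increasing) simp
    then have "norm (v j) * 2 ^ j \<le> 2 ^ (2 * (t + j)\<^sup>2 + (t + j))"
      using v[of j] by (meson mult_right_mono order_trans zero_le_numeral zero_le_power)
    then have "cmod (\<xi> (t + j)) * (norm (v j) * 2 ^ j) \<le> cmod (\<xi> (t + j)) * 2 ^ (2 * (t + j)\<^sup>2 + (t + j))"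
      by (intro mult_left_mono) auto
    also have "\<dots> \<le> C" using \<xi>[OF that] .
    finally show ?thesis by (simp add: norm_scaleC field_simps power_one_over)
  qed
  show "summable (\<lambda>j. norm (\<xi> (t + j) *\<^sub>C v j))"
    using le
    by (intro summable_comparison_test'[OF summable_mult[OF summable_geometric[of "1/2 :: real"], of C], of q])
      auto
qed

text \<open>
  On a series \<open>\<Sum> \<xi>\<^sub>j v\<^sub>j\<close> the orbit only shifts the coefficients and multiplies them by a scalar, and
  the values \<open>s\<^sub>t\<close> of \<open>f\<close> along the orbit determine both.
\<close>

lemma orbit_shift_form:
  fixes v :: "nat \<Rightarrow> 'a::complex_banach"
  assumes m: "2 \<le> m"
    and N: "clinear_operator N" "N (v 0) = 0" "\<And>i. N (v (Suc i)) = v i"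
    and f: "clinear_functional f" "f (v 0) = 1" "\<And>i. f (v (Suc i)) = 0"
    and s: "\<And>t. s t \<noteq> 0" "\<And>t. t < m - 1 \<Longrightarrow> s t = 1"
    and sum: "\<And>t. summable (\<lambda>j. (s (t + j) / lam m s (t + j)) *\<^sub>C v j)"
    and X: "\<And>t. X t = (\<Sum>j. (s (t + j) / lam m s (t + j)) *\<^sub>C v j)"
  shows "orbit_seq m (shift_form m f N) (\<lambda>i\<in>{..<m}. if i < m - 1 then v 0 else X i) t =
    (if t < m - 1 then v 0 else lam m s t *\<^sub>C X t)"
proof (induction t rule: less_induct)
  case (less t)
  let ?o = "orbit_seq m (shift_form m f N) (\<lambda>i\<in>{..<m}. if i < m - 1 then v 0 else X i)"
  interpret f: bounded_linear f using f(1) by (rule clinear_functional_bounded)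
  interpret N: bounded_linear N using N(1) by (rule clinear_operator_bounded)
  have lam0: "lam m s u \<noteq> 0" for u using s(1) by (intro lam_nonzero)
  have fX: "f (X u) = s u / lam m s u" for u
  proof -
    have "f (X u) = (\<Sum>j. f ((s (u + j) / lam m s (u + j)) *\<^sub>C v j))"
      unfolding X by (rule f.suminf[OF sum])
    also have "\<dots> = (\<Sum>j\<in>{0}. f ((s (u + j) / lam m s (u + j)) *\<^sub>C v j))"
    proof (rule suminf_finite)
      fix j :: nat assume "j \<notin> {0}"
      then show "f ((s (u + j) / lam m s (u + j)) *\<^sub>C v j) = 0"
        using f(3)[of "j - 1"] by (simp add: clinear_functional_scale[OF f(1)])
    qed simp
    finally show ?thesis by (simp add: clinear_functional_scale[OF f(1)] f(2))
  qed
  have NX: "N (X u) = X (Suc u)" for u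
  proof -
    define h where "h j = N ((s (u + j) / lam m s (u + j)) *\<^sub>C v j)" for j
    have "N (X u) = (\<Sum>j. h j)"
      unfolding X h_def by (rule N.suminf[OF sum])
    also have "summable h" unfolding h_def by (rule N.summable[OF sum])
    then have "(\<Sum>j. h j) = (\<Sum>j. h (Suc j)) + h 0" by (simp add: suminf_split_head)
    also have "h 0 = 0" by (simp add: h_def clinear_operator_scale[OF N(1)] N(2))
    also have "(\<Sum>j. h (Suc j)) = X (Suc u)"
      by (simp add: h_def X clinear_operator_scale[OF N(1)] N(3))
    finally show ?thesis by simp
  qed
  \<comment> \<open>An entry \<open>v 0\<close> gives the value \<open>1\<close>; for the other
    terms the scalar \<open>lam m s u\<close> cancels.\<close>
  have fo: "f (?o u) = s u" if "u < t" for u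
    unfolding less[OF that] using s lam0 by (simp add: clinear_functional_scale[OF f(1)] fX f(2))
  show ?case
  proof (cases "t < m")
    case True
    have "lam m s t = 1" using True by (simp add: lam_def)
    then show ?thesis using True by (subst orbit_seq.simps) (auto simp: scaleC_one)
  next
    case False
    have tm: "t - m + (m - 1) = t - 1" "Suc (t - 1) = t" using False m by auto
    have ot: "?o (t - 1) = lam m s (t - 1) *\<^sub>C X (t - 1)"
      by (subst less[of "t - 1"]) (use False m in auto)
    have "?o t = shift_form m f N (\<lambda>i\<in>{..<m}. ?o (t - m + i))"
      using False by (subst orbit_seq.simps) simp
    also have "\<dots> = (\<Prod>i<m-1. f (?o (t - m + i))) *\<^sub>C N (?o (t - 1))"
      unfolding shift_form_def using m tm by (auto intro!: arg_cong2[where f = scaleC] prod.cong)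
    also have "(\<Prod>i<m-1. f (?o (t - m + i))) = (\<Prod>i<m-1. s (t - m + i))"
      using False m by (intro prod.cong fo refl) auto
    also have "\<dots> = (\<Prod>u\<in>{t - m..<t - 1}. s u)"
      using False m
      by (intro prod.reindex_bij_witness[of _ "\<lambda>u. u - (t - m)" "\<lambda>i. t - m + i"]) auto
    also have "N (?o (t - 1)) = lam m s (t - 1) *\<^sub>C X t"
      unfolding ot by (simp only: clinear_operator_scale[OF N(1)] NX tm)
    also have "(\<Prod>u\<in>{t - m..<t - 1}. s u) *\<^sub>C lam m s (t - 1) *\<^sub>C X t = lam m s t *\<^sub>C X t"
      using lam_Suc[of m "t - 1" s] False tm by (simp add: scaleC_scaleC mult.commute)
    finally have "?o t = lam m s t *\<^sub>C X t" .
    moreover have "\<not> t < m - 1" using False by simp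
    ultimately show ?thesis by (simp only: if_False)
  qed
qed

lemma hypercyclic_shift_form:
  fixes v :: "nat \<Rightarrow> 'a::complex_banach"
  assumes sep: "separable_space (euclidean :: 'a topology)" and m: "2 \<le> m"
    and v: "\<And>i. norm (v i) \<le> 2 ^ (2 * i\<^sup>2)"
    and dense: "\<And>y \<epsilon>. 0 < \<epsilon> \<Longrightarrow> \<exists>n a. norm (y - (\<Sum>k<n. a k *\<^sub>C v k)) < \<epsilon>"
    and N: "clinear_operator N" "N (v 0) = 0" "\<And>i. N (v (Suc i)) = v i"
    and f: "clinear_functional f" "f (v 0) = 1" "\<And>i. f (v (Suc i)) = 0"
  shows "hypercyclic m (shift_form m f N)"
proof -
  obtain d :: "nat \<Rightarrow> 'a" where d: "\<And>y \<epsilon>. 0 < \<epsilon> \<Longrightarrow> \<exists>i. dist (d i) y < \<epsilon>"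
    using separable_dense_sequence[OF sep] by blast
  \<comment> \<open>Decoding \<open>l\<close> as a pair makes every \<open>d i\<close> the target of
    infinitely many blocks, with tolerances tending to \<open>0\<close>.\<close>
  have "\<exists>k b. m \<le> k \<and> (\<forall>j. b j \<noteq> 0) \<and>
      norm (d (fst (prod_decode l)) - (\<Sum>j<k. b j *\<^sub>C v j)) < (1 / 2) ^ l" for l
    by (rule dense_nonzero_coeffs[OF dense]) auto
  then obtain k b where k: "\<And>l. m \<le> k l" and b: "\<And>l j. b l j \<noteq> 0"
    and target: "\<And>l. norm (d (fst (prod_decode l)) - (\<Sum>j<k l. b l j *\<^sub>C v j)) < (1 / 2) ^ l"
    by metis
  obtain s n where s: "\<And>t. s t \<noteq> 0" "\<And>t. t < m - 1 \<Longrightarrow> s t = 1" and n: "\<And>l. m \<le> n l"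
    and blk: "\<And>l j. j < k l \<Longrightarrow> s (n l + j) = b l j * lam m s (n l + j) / lam m s (n l)"
    and small: "\<And>l t. n l + k l \<le> t \<Longrightarrow>
      cmod (s t) * (cmod (lam m s (n l)) * 2 ^ l) * 2 ^ (2 * t ^ 2 + t) \<le> cmod (lam m s t)"
    using block_sequence[where k = k and b = b, OF m k b] by blast
  have lam0: "lam m s t \<noteq> 0" for t using s(1) by (intro lam_nonzero)
  define \<xi> where "\<xi> t = s t / lam m s t" for t
  have \<xi>_small: "cmod (lam m s (n l)) * cmod (\<xi> u) * 2 ^ (2 * u\<^sup>2 + u) \<le> (1 / 2) ^ l"
    if "n l + k l \<le> u" for l u
    using small[OF that] lam0[of u] by (simp add: \<xi>_def norm_divide field_simps power_one_over)
  have sumn: "summable (\<lambda>j. norm (\<xi> (t + j) *\<^sub>C v j))" for t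
  proof (rule shift_series_summable(2)[OF v, where q = "n 0 + k 0"])
    show "cmod (\<xi> u) * 2 ^ (2 * u\<^sup>2 + u) \<le> 1 / cmod (lam m s (n 0))" if "n 0 + k 0 \<le> u" for u
      using \<xi>_small[OF that] lam0[of "n 0"] by (simp add: field_simps)
  qed
  then have sum: "summable (\<lambda>j. \<xi> (t + j) *\<^sub>C v j)" for t by (rule summable_norm_cancel)
  define X where "X t = (\<Sum>j. \<xi> (t + j) *\<^sub>C v j)" for t
  define x where "x = (\<lambda>i\<in>{..<m}. if i < m - 1 then v 0 else X i)"
  have orbit: "orbit_seq m (shift_form m f N) x t = lam m s t *\<^sub>C X t" if "m \<le> t" for t
  proof -
    have "\<not> t < m - 1" using that by simp
    then show ?thesis
      using orbit_shift_form[where s = s and X = X and t = t, OF m N f s] sum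
      by (simp add: x_def X_def \<xi>_def)
  qed
  \<comment> \<open>The terms \<open>j < k l\<close> reproduce the target combination exactly; the
    error is the tail after the block, bounded by \<open>\<xi>_small\<close>.\<close>
  have close: "norm (lam m s (n l) *\<^sub>C X (n l) - (\<Sum>j<k l. b l j *\<^sub>C v j)) \<le> 2 * (1 / 2) ^ l" for l
  proof -
    let ?c = "lam m s (n l)"
    have "(\<Sum>j<k l. b l j *\<^sub>C v j) = ?c *\<^sub>C (\<Sum>j<k l. \<xi> (n l + j) *\<^sub>C v j)"
      using lam0 by (simp add: scaleC.sum_right scaleC_scaleC \<xi>_def blk)
    moreover have "X (n l) = (\<Sum>j. \<xi> (n l + (j + k l)) *\<^sub>C v (j + k l)) + (\<Sum>j<k l. \<xi> (n l + j) *\<^sub>C v j)"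
      unfolding X_def using suminf_split_initial_segment[OF sum[of "n l"], of "k l"] by simp
    ultimately have "norm (?c *\<^sub>C X (n l) - (\<Sum>j<k l. b l j *\<^sub>C v j)) =
        cmod ?c * norm (\<Sum>j. \<xi> (n l + (j + k l)) *\<^sub>C v (j + k l))"
      by (simp add: norm_scaleC flip: scaleC.diff_right)
    also have "\<dots> \<le> cmod ?c * (2 * ((1 / 2) ^ l / cmod ?c))"
    proof (rule mult_left_mono)
      have le: "norm (\<xi> (n l + (j + k l)) *\<^sub>C v (j + k l)) \<le> (1 / 2) ^ l / cmod ?c * (1 / 2) ^ j" for j
      proof -
        have "norm (\<xi> (n l + (j + k l)) *\<^sub>C v (j + k l)) \<le> (1 / 2) ^ l / cmod ?c * (1 / 2) ^ (j + k l)"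
        proof (rule shift_series_summable(1)[OF v, where q = "n l + k l"])
          show "cmod (\<xi> u) * 2 ^ (2 * u\<^sup>2 + u) \<le> (1 / 2) ^ l / cmod ?c" if "n l + k l \<le> u" for u
            using \<xi>_small[OF that] lam0[of "n l"] by (simp add: field_simps)
        qed simp
        also have "\<dots> \<le> (1 / 2) ^ l / cmod ?c * (1 / 2) ^ j"
          by (intro mult_left_mono power_decreasing) auto
        finally show ?thesis .
      qed
      have "summable (\<lambda>j. norm (\<xi> (n l + (j + k l)) *\<^sub>C v (j + k l)))"
        using summable_ignore_initial_segment[OF sumn[of "n l"], of "k l"] by simp
      then have "norm (\<Sum>j. \<xi> (n l + (j + k l)) *\<^sub>C v (j + k l)) \<le>
          (\<Sum>j. (1 / 2) ^ l / cmod ?c * (1 / 2) ^ j)"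
        by (intro order_trans[OF summable_norm] suminf_le le summable_mult summable_geometric) auto
      also have "\<dots> = (1 / 2) ^ l / cmod ?c * 2"
        by (subst suminf_mult) (auto simp: suminf_geometric summable_geometric)
      finally show "norm (\<Sum>j. \<xi> (n l + (j + k l)) *\<^sub>C v (j + k l)) \<le> 2 * ((1 / 2) ^ l / cmod ?c)"
        by (simp only: mult.commute)
    qed simp
    finally show ?thesis using lam0[of "n l"] by simp
  qed
  have "y \<in> closure (Orb m (shift_form m f N) x)" for y
    unfolding closure_approachable
  proof (intro allI impI)
    fix \<epsilon> :: real assume \<epsilon>: "0 < \<epsilon>"
    obtain i where i: "dist (d i) y < \<epsilon> / 2" using d half_gt_zero[OF \<epsilon>] by blast
    obtain r where r: "(1 / 2 :: real) ^ r < \<epsilon> / 6"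
      using real_arch_pow_inv[of "\<epsilon> / 6" "1 / 2"] \<epsilon> by auto
    define l where "l = prod_encode (i, r)"
    have "(1 / 2 :: real) ^ l \<le> (1 / 2) ^ r"
      unfolding l_def by (intro power_decreasing le_prod_encode_2) auto
    then have l: "(1 / 2 :: real) ^ l < \<epsilon> / 6" using r by (rule le_less_trans)
    \<comment> \<open>Error budget: \<open>\<epsilon> / 3\<close> for the tail,
      \<open>\<epsilon> / 6\<close> for the block target and \<open>\<epsilon> / 2\<close> for
      \<open>d i\<close>.\<close>
    have "dist (lam m s (n l) *\<^sub>C X (n l)) (\<Sum>j<k l. b l j *\<^sub>C v j) < \<epsilon> / 3"
      using close[of l] l by (simp add: dist_norm)
    moreover have "dist (d i) (\<Sum>j<k l. b l j *\<^sub>C v j) < \<epsilon> / 6"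
      using target[of l] l by (simp add: dist_norm l_def)
    ultimately have "dist (lam m s (n l) *\<^sub>C X (n l)) y < \<epsilon>"
      using i by metric
    then have "dist (orbit_seq m (shift_form m f N) x (n l)) y < \<epsilon>"
      using orbit[OF n] by simp
    then show "\<exists>z\<in>Orb m (shift_form m f N) x. dist z y < \<epsilon>"
      by (auto simp: Orb_def)
  qed
  moreover have "x \<in> {..<m} \<rightarrow>\<^sub>E UNIV" by (simp add: x_def)
  ultimately show ?thesis by (auto simp: hypercyclic_def)
qed

lemma hypercyclic_unipotent:
  fixes v :: "nat \<Rightarrow> 'a::complex_banach"
  assumes sep: "separable_space (euclidean :: 'a topology)"
    and T: "clinear_operator T" and v: "\<And>i. T (v i) = (\<Sum>l\<le>i. of_nat (i choose l) *\<^sub>C v l)"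
    and dense: "\<And>y \<epsilon>. 0 < \<epsilon> \<Longrightarrow> \<exists>n a. norm (y - (\<Sum>k<n. a k *\<^sub>C v k)) < \<epsilon>"
  shows "hypercyclic 1 (\<lambda>u. T (u 0))"
proof -
  have "continuous_on UNIV T"
    using T by (intro linear_continuous_on clinear_operator_bounded)
  then obtain x where x: "closure (range (\<lambda>n. (T ^^ n) x)) = UNIV"
    using transitive_imp_dense_orbit[OF sep _ unipotent_transitive[OF T v dense]] by blast
  have "Orb 1 (\<lambda>u. T (u 0)) (\<lambda>i\<in>{..<1}. x) = range (\<lambda>n. (T ^^ n) x)"
    unfolding Orb_def orbit_seq_1 by simp
  then show ?thesis
    unfolding hypercyclic_def using x by (intro bexI[of _ "\<lambda>i\<in>{..<1}. x"]) auto
qed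

theorem theorem3p3:
  assumes "separable_space (euclidean :: 'a::complex_banach topology)"
    and "infinite_dimensional TYPE('a)"
  shows "\<forall>m\<ge>1. \<exists>M :: (nat \<Rightarrow> 'a) \<Rightarrow> 'a. continuous_multilinear m M \<and> hypercyclic m M"
proof (intro allI impI)
  fix m :: nat assume m: "1 \<le> m"
  obtain v :: "nat \<Rightarrow> 'a" and N f T
    where v: "\<And>i. norm (v i) \<le> 2 ^ (2 * i\<^sup>2)"
      and dense: "\<And>y \<epsilon>. 0 < \<epsilon> \<Longrightarrow> \<exists>n a. norm (y - (\<Sum>k<n. a k *\<^sub>C v k)) < \<epsilon>"
      and N: "clinear_operator N" "N (v 0) = 0" "\<And>i. N (v (Suc i)) = v i"
      and f: "clinear_functional f" "f (v 0) = 1" "\<And>i. f (v (Suc i)) = 0"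
      and T: "clinear_operator T" "\<And>i. T (v i) = (\<Sum>l\<le>i. of_nat (i choose l) *\<^sub>C v l)"
    by (rule shift_basis[OF assms]) (rule that)
  show "\<exists>M :: (nat \<Rightarrow> 'a) \<Rightarrow> 'a. continuous_multilinear m M \<and> hypercyclic m M"
  \<comment> \<open>For \<open>m = 1\<close> the product of scalars in \<open>shift_form\<close> is
    empty, so nothing enlarges the starting vector; this case uses \<open>T\<close>.\<close>
  proof (cases "m = 1")
    case True
    then show ?thesis
      using continuous_multilinear_1[OF T(1)] hypercyclic_unipotent[OF assms(1) T dense] by blast
  next
    case False
    then have "2 \<le> m" using m by simp
    then show ?thesis
      using continuous_multilinear_shift_form[OF m f(1) N(1)]
        hypercyclic_shift_form[OF assms(1) _ v dense N f] by blast
  qed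
qed

end
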